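(* Let $f(h)=h^{-6}-h^{-3}$ for $h>0$. For $\epsilon>0$ and $\bar h>0$ consider the problem of finding positive functions $h\in C^2([0,1])$ such that $$\epsilon^2 h_{xx}+f(h)-\int_0^1 f(h(x))\,dx=0\ \ (0<x<1),\qquad h(0)=h(1),\quad h_x(0)=h_x(1),\qquad \int_0^1 h(x)\,dx=\bar h .$$ For every $\epsilon>0$ the constant function $h\equiv\bar h$ is a solution. Let $$h_-=\left(\frac{426-\sqrt{33048}}{114}\right)^{1/3}\approx 1.289,\qquad h_+=\left(\frac{426+\sqrt{33048}}{114}\right)^{1/3}\approx 1.747,$$ i.e. the two positive roots of $57h^6-426h^3+651=0$. Then, with $1/\epsilon$ used as the bifurcation parameter and $\bar h$ held fixed, the bifurcations of nontrivial (non-constant) solutions from the constant solution $h\equiv\bar h$, which occur at $\epsilon=\epsilon_k=\sqrt{f'(\bar h)}/(2k\pi)$, $k=1,2,3,\dots$, are (i) supercritical if $h_-<\bar h<h_+$; (ii) subcritical if $2^{1/3}<\bar h<h_-$ or if $\bar h>h_+$.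
   Context: Here $f'(\bar h)=-6\bar h^{-7}+3\bar h^{-4}$, which is positive exactly when $\bar h>2^{1/3}\approx 1.259$. A nontrivial solution is a non-constant one. For fixed $\bar h$, a bifurcation of nontrivial solutions from the constant solution at $\epsilon=\epsilon_k$ means that every neighbourhood of $(\epsilon_k,\bar h)$ in $(0,\infty)\times C^2([0,1])$ contains pairs $(\epsilon,h)$ with $h$ a nontrivial solution of the problem for that $\epsilon$ (and that $\bar h$). With $1/\epsilon$ as the bifurcation parameter, the bifurcation at $\epsilon_k$ is called supercritical if, in a sufficiently small neighbourhood of $(\epsilon_k,\bar h)$, all nontrivial solutions $(\epsilon,h)$ have $1/\epsilon>1/\epsilon_k$, and subcritical if, in a sufficiently small neighbourhood, all nontrivial solutions have $1/\epsilon<1/\epsilon_k$. *)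

theory Defs
  imports "HOL-Analysis.Analysis"
begin

definition nonlin :: "real \<Rightarrow> real" where
  "nonlin h = h powi (-6) - h powi (-3)"

text \<open>Elements of \<open>C\<^sup>2([0,1])\<close> are represented by functions on the reals of which only the
  restriction to \<open>[0,1]\<close> matters. Derivatives are therefore taken within \<open>[0,1]\<close>, hence are
  one-sided at the two end points.\<close>

definition dx :: "(real \<Rightarrow> real) \<Rightarrow> real \<Rightarrow> real" where
  "dx h x = vector_derivative h (at x within {0..1})"

definition C2 :: "(real \<Rightarrow> real) set" where
  "C2 = {h. h differentiable_on {0..1} \<and> dx h differentiable_on {0..1}
            \<and> continuous_on {0..1} (dx (dx h))}"

definition C2_norm :: "(real \<Rightarrow> real) \<Rightarrow> real" where
  "C2_norm u = (SUP x\<in>{0..1}. \<bar>u x\<bar>) + (SUP x\<in>{0..1}. \<bar>dx u x\<bar>) + (SUP x\<in>{0..1}. \<bar>dx (dx u) x\<bar>)"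

definition solution :: "real \<Rightarrow> real \<Rightarrow> (real \<Rightarrow> real) \<Rightarrow> bool" where
  "solution hbar \<epsilon> h \<longleftrightarrow>
     h \<in> C2 \<and> (\<forall>x\<in>{0..1}. h x > 0) \<and>
     (\<forall>x\<in>{0<..<1}. \<epsilon>\<^sup>2 * dx (dx h) x + nonlin (h x) - integral {0..1} (\<lambda>y. nonlin (h y)) = 0) \<and>
     h 0 = h 1 \<and> dx h 0 = dx h 1 \<and> integral {0..1} h = hbar"

definition nontrivial_solution :: "real \<Rightarrow> real \<Rightarrow> (real \<Rightarrow> real) \<Rightarrow> bool" where
  "nontrivial_solution hbar \<epsilon> h \<longleftrightarrow> solution hbar \<epsilon> h \<and> \<not> h constant_on {0..1}"

text \<open>The sets \<open>nbhd hbar \<epsilon>0 \<delta>\<close> with \<open>\<delta> > 0\<close> form a neighbourhood basis of the pair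
  \<open>(\<epsilon>0, hbar)\<close>, \<open>hbar\<close> read as a constant function, in \<open>(0,\<infinity>) \<times> C\<^sup>2([0,1])\<close>.\<close>

definition nbhd :: "real \<Rightarrow> real \<Rightarrow> real \<Rightarrow> (real \<times> (real \<Rightarrow> real)) set" where
  "nbhd hbar \<epsilon>0 \<delta> = {(\<epsilon>, h). 0 < \<epsilon> \<and> \<bar>\<epsilon> - \<epsilon>0\<bar> < \<delta> \<and> h \<in> C2 \<and> C2_norm (\<lambda>x. h x - hbar) < \<delta>}"

definition bifurcation_at :: "real \<Rightarrow> real \<Rightarrow> bool" where
  "bifurcation_at hbar \<epsilon>0 \<longleftrightarrow>
     (\<forall>\<delta>>0. \<exists>(\<epsilon>, h)\<in>nbhd hbar \<epsilon>0 \<delta>. nontrivial_solution hbar \<epsilon> h)"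

text \<open>The bifurcation parameter is \<open>1 / \<epsilon>\<close>.\<close>

definition supercritical_at :: "real \<Rightarrow> real \<Rightarrow> bool" where
  "supercritical_at hbar \<epsilon>0 \<longleftrightarrow> bifurcation_at hbar \<epsilon>0 \<and>
     (\<exists>\<delta>>0. \<forall>(\<epsilon>, h)\<in>nbhd hbar \<epsilon>0 \<delta>. nontrivial_solution hbar \<epsilon> h \<longrightarrow> 1 / \<epsilon> > 1 / \<epsilon>0)"

definition subcritical_at :: "real \<Rightarrow> real \<Rightarrow> bool" where
  "subcritical_at hbar \<epsilon>0 \<longleftrightarrow> bifurcation_at hbar \<epsilon>0 \<and>
     (\<exists>\<delta>>0. \<forall>(\<epsilon>, h)\<in>nbhd hbar \<epsilon>0 \<delta>. nontrivial_solution hbar \<epsilon> h \<longrightarrow> 1 / \<epsilon> < 1 / \<epsilon>0)"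

definition eps :: "real \<Rightarrow> nat \<Rightarrow> real" where
  "eps hbar k = sqrt (deriv nonlin hbar) / (2 * real k * pi)"

definition h_minus :: real where
  "h_minus = root 3 ((426 - sqrt 33048) / 114)"

definition h_plus :: real where
  "h_plus = root 3 ((426 + sqrt 33048) / 114)"

end

theory Submission
  imports Defs "HOL-Real_Asymp.Real_Asymp"
begin

text \<open>
  A solution \<open>h\<close> conserves \<open>\<epsilon>\<^sup>2 h\<^sub>x\<^sup>2 / 2 + F(h) - c h\<close> with \<open>F' = f\<close> and \<open>c = \<integral> f(h)\<close>. If \<open>m - r\<close> and
  \<open>m + r\<close> are its extreme values, then \<open>c\<close> is the slope of the chord of \<open>F\<close> between them and
  \<open>\<epsilon>\<^sup>2 h\<^sub>x\<^sup>2 = (r\<^sup>2 - (h - m)\<^sup>2) Q(h)\<close>, where \<open>Q\<close> is twice a second divided difference of \<open>F\<close>, an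
  explicit function that is smooth up to \<open>r = 0\<close>. Writing \<open>h = m + r cos \<phi>\<close> turns the equation into
  \<open>\<epsilon> \<phi>\<^sub>x = sqrt Q\<close>, so nontrivial solutions correspond to \<open>(m, r, n)\<close> with
  \<open>\<epsilon> \<integral> 1 / sqrt Q d\<phi> = 1\<close> and \<open>\<integral> (m - hbar + r cos \<phi>) / sqrt Q d\<phi> = 0\<close> over \<open>n\<close> full turns.

  For given small \<open>r\<close> the second integral changes sign between \<open>m = hbar - r\<close> and \<open>m = hbar + r\<close>,
  which gives existence. Expanding \<open>Q\<close> to second order in \<open>r\<close> gives
  \<open>sqrt (f'(hbar)) / \<epsilon> = 2 \<pi> n (1 + \<kappa> r\<^sup>2 + O(r\<^sup>3))\<close> with
  \<open>\<kappa> = - (f''\<^sup>2 + 3 f' f''') / (48 f'\<^sup>2)\<close> at \<open>hbar\<close>. Hence small solutions accumulate only at the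
  \<open>\<epsilon>\<^sub>k\<close>, and the direction of the bifurcation is the sign of \<open>\<kappa>\<close>.
\<close>

section \<open>Divided differences of the primitive of the nonlinearity\<close>

definition prim :: "real \<Rightarrow> real" where "prim z = 1 / (2 * z^2) - 1 / (5 * z^5)"
definition nonlin1 :: "real \<Rightarrow> real" where "nonlin1 z = 3 / z^4 - 6 / z^7"
definition nonlin2 :: "real \<Rightarrow> real" where "nonlin2 z = 42 / z^8 - 12 / z^5"
definition nonlin3 :: "real \<Rightarrow> real" where "nonlin3 z = 60 / z^6 - 336 / z^9"
definition nonlin4 :: "real \<Rightarrow> real" where "nonlin4 z = 3024 / z^10 - 360 / z^7"

lemma nonlin_eq: "nonlin z = 1 / z^6 - 1 / z^3"
  by (simp add: nonlin_def power_int_def divide_inverse power_inverse)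

lemma prim_deriv: "z > 0 \<Longrightarrow> (prim has_real_derivative nonlin z) (at z)"
  unfolding prim_def nonlin_eq
  by (auto intro!: derivative_eq_intros simp: field_simps eval_nat_numeral)

lemma nonlin_deriv: "z > 0 \<Longrightarrow> (nonlin has_real_derivative nonlin1 z) (at z)"
  unfolding nonlin_eq nonlin1_def
  by (auto intro!: derivative_eq_intros simp: field_simps eval_nat_numeral)

lemma nonlin1_deriv: "z > 0 \<Longrightarrow> (nonlin1 has_real_derivative nonlin2 z) (at z)"
  unfolding nonlin1_def nonlin2_def
  by (auto intro!: derivative_eq_intros simp: field_simps eval_nat_numeral)

lemma nonlin2_deriv: "z > 0 \<Longrightarrow> (nonlin2 has_real_derivative nonlin3 z) (at z)"
  unfolding nonlin2_def nonlin3_def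
  by (auto intro!: derivative_eq_intros simp: field_simps eval_nat_numeral)

lemma nonlin3_deriv: "z > 0 \<Longrightarrow> (nonlin3 has_real_derivative nonlin4 z) (at z)"
  unfolding nonlin3_def nonlin4_def
  by (auto intro!: derivative_eq_intros simp: field_simps eval_nat_numeral)

section \<open>Error of linear interpolation\<close>

text \<open>Adding \<open>M / 2 * z^2\<close> makes \<open>R\<close> convex, so the sum lies below
  its chord; for the square alone the gap to the chord, times \<open>b - a\<close>, is exactly
  \<open>(b - a) * (b - x) * (x - a)\<close>.\<close>

lemma chord_above:
  fixes R R1 R2 :: "real \<Rightarrow> real"
  assumes "a < b" "x \<in> {a..b}"
    and R1: "\<And>z. z \<in> {a..b} \<Longrightarrow> (R has_real_derivative R1 z) (at z)"
    and R2: "\<And>z. z \<in> {a..b} \<Longrightarrow> (R1 has_real_derivative R2 z) (at z)"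
    and lb: "\<And>z. z \<in> {a..b} \<Longrightarrow> - M \<le> R2 z"
  shows "R x * (b - a) - (R a * (b - x) + R b * (x - a)) \<le> M / 2 * ((b - a) * (b - x) * (x - a))"
proof -
  define K where "K = M / 2"
  define g where "g z = R z + K * z^2" for z
  have "convex_on {a..b} g"
  proof (rule f''_ge0_imp_convex)
    show "(g has_real_derivative R1 z + M * z) (at z)" if "z \<in> {a..b}" for z
      unfolding g_def K_def using R1[OF that] by (auto intro!: derivative_eq_intros)
    show "((\<lambda>z. R1 z + M * z) has_real_derivative R2 z + M) (at z)" if "z \<in> {a..b}" for z
      using R2[OF that] by (auto intro!: derivative_eq_intros)
    show "0 \<le> R2 z + M" if "z \<in> {a..b}" for z
      using lb[OF that] by simp
  qed simp
  from convex_onD[OF this, of "(x - a) / (b - a)" a b] assms(1,2)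
  have "g ((1 - (x - a) / (b - a)) *\<^sub>R a + ((x - a) / (b - a)) *\<^sub>R b)
      \<le> (1 - (x - a) / (b - a)) * g a + ((x - a) / (b - a)) * g b"
    by (auto simp: field_simps)
  moreover have "(1 - (x - a) / (b - a)) *\<^sub>R a + ((x - a) / (b - a)) *\<^sub>R b = x"
    using assms(1) by (simp add: divide_simps) (simp add: algebra_simps)
  moreover have "(1 - (x - a) / (b - a)) * g a + ((x - a) / (b - a)) * g b
      = ((b - x) * g a + (x - a) * g b) / (b - a)"
    using assms(1) by (simp add: divide_simps)
  ultimately have "g x * (b - a) \<le> (b - x) * g a + (x - a) * g b"
    using assms(1) by (simp add: pos_le_divide_eq)
  then show ?thesis
    unfolding g_def K_def[symmetric] by (simp add: algebra_simps power2_eq_square)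
qed

text \<open>The one-sided estimate, applied to \<open>R\<close> and to \<open>- R\<close>. The
  quantity inside the absolute value is a second divided difference before division, so a bound on
  \<open>R2\<close> controls divided differences of \<open>R\<close>.\<close>

lemma chord_bound:
  fixes R R1 R2 :: "real \<Rightarrow> real"
  assumes "a < b" "x \<in> {a..b}"
    and R1: "\<And>z. z \<in> {a..b} \<Longrightarrow> (R has_real_derivative R1 z) (at z)"
    and R2: "\<And>z. z \<in> {a..b} \<Longrightarrow> (R1 has_real_derivative R2 z) (at z)"
    and M: "\<And>z. z \<in> {a..b} \<Longrightarrow> \<bar>R2 z\<bar> \<le> M"
  shows "\<bar>R a * (b - x) + R b * (x - a) - R x * (b - a)\<bar> \<le> M / 2 * ((b - a) * (b - x) * (x - a))"
proof -
  have "R x * (b - a) - (R a * (b - x) + R b * (x - a)) \<le> M / 2 * ((b - a) * (b - x) * (x - a))"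
    by (rule chord_above[OF assms(1,2) R1 R2]) (use M in \<open>auto simp: abs_le_iff minus_le_iff\<close>)
  moreover have "(- R x) * (b - a) - ((- R a) * (b - x) + (- R b) * (x - a))
      \<le> M / 2 * ((b - a) * (b - x) * (x - a))"
    by (rule chord_above[where R = "\<lambda>z. - R z" and ?R1.0 = "\<lambda>z. - R1 z" and ?R2.0 = "\<lambda>z. - R2 z", OF assms(1,2)])
       (use R1 R2 M in \<open>auto intro!: derivative_eq_intros simp: abs_le_iff\<close>)
  moreover have "(- R x) * (b - a) - ((- R a) * (b - x) + (- R b) * (x - a))
      = R a * (b - x) + R b * (x - a) - R x * (b - a)" by (simp add: algebra_simps)
  ultimately show ?thesis by (auto simp only: abs_le_iff minus_diff_eq)
qed

section \<open>The second divided difference and its expansion\<close>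

text \<open>The second divided difference of \<open>1 / z^n\<close> is the product of the three
  reciprocals times their complete homogeneous symmetric polynomial of degree \<open>n - 1\<close>.
  The two summands are the cases \<open>n = 2\<close> and \<open>n = 5\<close>, with weights
  \<open>2 * (1 / 2)\<close> and \<open>- 2 * (1 / 5)\<close>.\<close>

definition dd_inv :: "real \<Rightarrow> real \<Rightarrow> real \<Rightarrow> real" where
  "dd_inv p q s = p * q * s * (p + q + s) - 2 / 5 * (p * q * s) *
     (p^4 + q^4 + s^4 + p^3 * q + p^3 * s + q^3 * p + q^3 * s + s^3 * p + s^3 * q
      + p^2 * q^2 + p^2 * s^2 + q^2 * s^2 + p^2 * q * s + p * q^2 * s + p * q * s^2)"

text \<open>Twice the second divided difference of \<open>prim\<close> at \<open>a\<close>, \<open>b\<close>, \<open>x\<close>, written as a polynomial in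
  the reciprocals so that it makes sense when the points coincide.\<close>

definition dd :: "real \<Rightarrow> real \<Rightarrow> real \<Rightarrow> real" where
  "dd a b x = dd_inv (1 / a) (1 / b) (1 / x)"

text \<open>Since \<open>b - x = (s - q) / (q * s)\<close> in the reciprocals, and similarly for the
  other differences, multiplying by \<open>(p * q * s)^2\<close> leaves a polynomial identity. The
  division-free form also covers coinciding points.\<close>

lemma dd_identity:
  assumes "a > 0" "b > 0" "x > 0"
  shows "2 * (prim a * (b - x) + prim b * (x - a) - prim x * (b - a))
     = (b - a) * (b - x) * (x - a) * dd a b x"
proof -
  define p q s where "p = 1 / a" "q = 1 / b" "s = 1 / x"
  have nz: "p \<noteq> 0" "q \<noteq> 0" "s \<noteq> 0" using assms by (auto simp: p_q_s_def)
  have e: "a = 1 / p" "b = 1 / q" "x = 1 / s" by (auto simp: p_q_s_def)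
  have pr: "prim (1 / p) = p^2 / 2 - p^5 / 5" if "p \<noteq> 0" for p
    unfolding prim_def by (simp add: power_divide)
  have "2 * (prim a * (b - x) + prim b * (x - a) - prim x * (b - a)) * (p * q * s)
      = 2 * ((p^2 / 2 - p^5 / 5) * p * (s - q) + (q^2 / 2 - q^5 / 5) * q * (p - s) - (s^2 / 2 - s^5 / 5) * s * (p - q))"
    unfolding e pr[OF nz(1)] pr[OF nz(2)] pr[OF nz(3)]
    using nz by (simp add: field_simps)
  also have "\<dots> * (p * q * s) = (p - q) * (s - q) * (p - s) * dd_inv p q s"
    unfolding dd_inv_def by algebra
  also have "dd_inv p q s = dd a b x" by (simp add: dd_def e)
  also have "(p - q) * (s - q) * (p - s) = (b - a) * (b - x) * (x - a) * (p * q * s)^2"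
    unfolding e using nz by (simp add: field_simps power2_eq_square)
  finally have "(p * q * s)^2 * (2 * (prim a * (b - x) + prim b * (x - a) - prim x * (b - a)))
     = (p * q * s)^2 * ((b - a) * (b - x) * (x - a) * dd a b x)"
    by (simp add: algebra_simps power2_eq_square)
  then show ?thesis using nz by simp
qed

text \<open>Lagrange remainder of order three. The condition on \<open>v\<close> keeps the
  intermediate point above \<open>h / 2\<close>, where both monomials of \<open>nonlin4\<close> are
  bounded by their values at \<open>h / 2\<close>; the factor \<open>1 / 6\<close> is given
  away.\<close>

lemma nonlin1_taylor:
  assumes h: "h > 0" and v: "\<bar>v\<bar> \<le> h / 2"
  shows "\<bar>nonlin1 (h + v) - (nonlin1 h + nonlin2 h * v + nonlin3 h / 2 * v^2)\<bar>
     \<le> (3024 / (h/2)^10 + 360 / (h/2)^7) * \<bar>v\<bar>^3"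
proof (cases "v = 0")
  case False
  define D where "D j = (if j = 0 then nonlin1 else if j = 1 then nonlin2 else if j = 2 then nonlin3 else nonlin4)" for j :: nat
  have "\<exists>t. (if h + v < h then h + v < t \<and> t < h else h < t \<and> t < h + v) \<and>
      nonlin1 (h + v) = (\<Sum>m<3. D m h / fact m * (h + v - h) ^ m) + D 3 t / fact 3 * (h + v - h) ^ 3"
  proof (rule Taylor[where a = "h / 2" and b = "3 * h / 2"])
    show "\<forall>m t. m < 3 \<and> h / 2 \<le> t \<and> t \<le> 3 * h / 2 \<longrightarrow> (D m has_real_derivative D (Suc m) t) (at t)"
    proof (intro allI impI)
      fix m :: nat and t assume "m < 3 \<and> h / 2 \<le> t \<and> t \<le> 3 * h / 2"
      then have "m = 0 \<or> m = 1 \<or> m = 2" "t > 0" using h by auto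
      then show "(D m has_real_derivative D (Suc m) t) (at t)"
        by (auto simp: D_def nonlin1_deriv nonlin2_deriv nonlin3_deriv)
    qed
  qed (use h v False in \<open>auto simp: D_def abs_le_iff\<close>)
  then obtain t where t: "if h + v < h then h + v < t \<and> t < h else h < t \<and> t < h + v"
    and eq: "nonlin1 (h + v) = (\<Sum>m<3. D m h / fact m * v ^ m) + D 3 t / fact 3 * v ^ 3"
    by auto
  have th: "t \<ge> h / 2" using t v by (auto split: if_splits simp: abs_le_iff)
  have "\<bar>nonlin4 t\<bar> \<le> 3024 / t^10 + 360 / t^7"
    unfolding nonlin4_def using th h by (intro order_trans[OF abs_triangle_ineq4]) auto
  also have "\<dots> \<le> 3024 / (h/2)^10 + 360 / (h/2)^7"
    using th h by (intro add_mono divide_left_mono power_mono mult_pos_pos zero_less_power) auto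
  finally have n4: "\<bar>nonlin4 t\<bar> \<le> 3024 / (h/2)^10 + 360 / (h/2)^7" .
  have "nonlin1 (h + v) - (nonlin1 h + nonlin2 h * v + nonlin3 h / 2 * v^2) = nonlin4 t / 6 * v^3"
    using eq by (simp add: D_def eval_nat_numeral)
  also have "\<bar>\<dots>\<bar> \<le> \<bar>nonlin4 t\<bar> * \<bar>v\<bar>^3"
    by (simp add: abs_mult power_abs divide_simps)
  also have "\<dots> \<le> (3024 / (h/2)^10 + 360 / (h/2)^7) * \<bar>v\<bar>^3"
    by (rule mult_right_mono[OF n4]) simp
  finally show ?thesis .
qed (use h in auto)

text \<open>The value of \<open>dd\<close> at \<open>h + u - r\<close>, \<open>h + u + r\<close>, \<open>h + u + y\<close> when \<open>prim\<close> is replaced by its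
  Taylor polynomial of degree four at \<open>h\<close>.\<close>

definition dd_quad :: "real \<Rightarrow> real \<Rightarrow> real \<Rightarrow> real \<Rightarrow> real" where
  "dd_quad h u r y = nonlin1 h + nonlin2 h * (u + y / 3)
     + nonlin3 h / 2 * (u^2 + 2 * u * y / 3 + (r^2 + y^2) / 6)"

lemma continuous_on_dd:
  assumes "continuous_on S f" "continuous_on S g" "continuous_on S k"
    "\<And>z. z \<in> S \<Longrightarrow> f z > 0" "\<And>z. z \<in> S \<Longrightarrow> g z > 0" "\<And>z. z \<in> S \<Longrightarrow> k z > 0"
  shows "continuous_on S (\<lambda>z. dd (f z) (g z) (k z))"
  unfolding dd_def dd_inv_def using assms(4-6)
  by (intro continuous_intros assms(1-3)) (metis less_irrefl)+

text \<open>Subtracting the Taylor polynomial from \<open>prim\<close> leaves a function whose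
  second derivative is \<open>O(r^3)\<close> between the three points, so the interpolation estimate
  bounds its divided difference. Strictness of \<open>\<bar>y\<bar> < r\<close> makes the points
  distinct, so that their differences can be cancelled.\<close>

lemma dd_expansion_open:
  assumes h: "h > 0" and r: "0 < r" "r < h / 4" and u: "\<bar>u\<bar> \<le> r" and y: "\<bar>y\<bar> < r"
  shows "\<bar>dd (h + u - r) (h + u + r) (h + u + y) - dd_quad h u r y\<bar>
    \<le> 8 * (3024 / (h/2)^10 + 360 / (h/2)^7) * r^3"
proof -
  define C where "C = 3024 / (h/2)^10 + 360 / (h/2)^7"
  have C: "C > 0" unfolding C_def using h by (auto intro!: add_pos_pos)
  define a b x where "a = h + u - r" "b = h + u + r" "x = h + u + y"
  have ab: "a > 0" "b > 0" "x > 0" "a < x" "x < b" using r u y by (auto simp: a_b_x_def)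
  \<comment> \<open>The terms of degree zero and one are left out because a second divided
    difference annihilates them.\<close>
  define P where "P z = nonlin1 h / 2 * (z - h)^2 + nonlin2 h / 6 * (z - h)^3 + nonlin3 h / 24 * (z - h)^4" for z
  define R where "R z = prim z - P z" for z
  define R1 where "R1 z = nonlin z - (nonlin1 h * (z - h) + nonlin2 h / 2 * (z - h)^2 + nonlin3 h / 6 * (z - h)^3)" for z
  define R2 where "R2 z = nonlin1 z - (nonlin1 h + nonlin2 h * (z - h) + nonlin3 h / 2 * (z - h)^2)" for z
  have key: "\<bar>R a * (b - x) + R b * (x - a) - R x * (b - a)\<bar> \<le> (C * (8 * r^3)) / 2 * ((b - a) * (b - x) * (x - a))"
  proof (rule chord_bound)
    fix z assume "z \<in> {a..b}"
    \<comment> \<open>The interval has half-width \<open>r\<close> about \<open>h + u\<close>, so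
      its points are within \<open>2 * r\<close> of \<open>h\<close>; this produces the factor
      8.\<close>
    then have z: "z > 0" "\<bar>z - h\<bar> \<le> 2 * r" using ab u by (auto simp: a_b_x_def abs_le_iff)
    show "(R has_real_derivative R1 z) (at z)"
      unfolding R_def R1_def P_def using prim_deriv[OF z(1)]
      by (auto intro!: derivative_eq_intros simp: field_simps eval_nat_numeral)
    show "(R1 has_real_derivative R2 z) (at z)"
      unfolding R1_def R2_def using nonlin_deriv[OF z(1)]
      by (auto intro!: derivative_eq_intros simp: field_simps eval_nat_numeral)
    have "\<bar>R2 z\<bar> \<le> C * \<bar>z - h\<bar>^3"
      unfolding R2_def C_def using nonlin1_taylor[OF h, of "z - h"] z r by simp
    also have "\<dots> \<le> C * (2 * r)^3"
      using C z by (intro mult_left_mono power_mono) auto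
    finally show "\<bar>R2 z\<bar> \<le> C * (8 * r^3)" by (simp add: power_mult_distrib)
  qed (use ab in auto)
  have "2 * (P a * (b - x) + P b * (x - a) - P x * (b - a)) = (b - a) * (b - x) * (x - a) * dd_quad h u r y"
    unfolding P_def dd_quad_def a_b_x_def by (simp add: field_simps) algebra
  with dd_identity[OF ab(1-3)]
  have "R a * (b - x) + R b * (x - a) - R x * (b - a)
     = (b - a) * (b - x) * (x - a) / 2 * (dd a b x - dd_quad h u r y)"
    unfolding R_def by (simp add: algebra_simps)
  with key have "(b - a) * (b - x) * (x - a) / 2 * \<bar>dd a b x - dd_quad h u r y\<bar>
     \<le> (b - a) * (b - x) * (x - a) / 2 * (8 * C * r^3)"
    using ab by (simp add: abs_mult mult_ac)
  moreover have "(b - a) * (b - x) * (x - a) / 2 > 0" using ab by simp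
  ultimately have "\<bar>dd a b x - dd_quad h u r y\<bar> \<le> 8 * C * r^3"
    by (simp only: mult_le_cancel_left_pos)
  then show ?thesis by (simp only: C_def a_b_x_def)
qed

text \<open>Continuity in \<open>y\<close> adds the end points \<open>y = r\<close> and
  \<open>y = - r\<close>, which the phase reaches at every turning point.\<close>

lemma dd_expansion:
  assumes h: "h > 0" and r: "0 < r" "r < h / 4" and u: "\<bar>u\<bar> \<le> r" and y: "\<bar>y\<bar> \<le> r"
  shows "\<bar>dd (h + u - r) (h + u + r) (h + u + y) - dd_quad h u r y\<bar>
    \<le> 8 * (3024 / (h/2)^10 + 360 / (h/2)^7) * r^3"
proof -
  let ?f = "\<lambda>y. \<bar>dd (h + u - r) (h + u + r) (h + u + y) - dd_quad h u r y\<bar>"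
  have cl: "closure {-r<..<r} = {-r..r}" using r by (simp add: closure_greaterThanLessThan)
  have "continuous_on (closure {-r<..<r}) ?f"
    unfolding cl dd_quad_def using r u
    by (intro continuous_intros continuous_on_dd) auto
  from continuous_le_on_closure[OF this, of y] show ?thesis
    using dd_expansion_open[OF h r u] y unfolding cl by (auto simp: abs_less_iff abs_le_iff)
qed

section \<open>Expansion of the period and of the mean\<close>

lemma inverse_sqrt_expansion:
  "\<exists>\<delta> C. \<delta> > 0 \<and> C > 0 \<and> (\<forall>t::real. \<bar>t\<bar> < \<delta> \<longrightarrow> \<bar>1 / sqrt (1 + t) - (1 - t / 2 + 3 / 8 * t^2)\<bar> \<le> C * \<bar>t\<bar>^3)"
proof -
  have "(\<lambda>t. 1 / sqrt (1 + t) - (1 - t / 2 + 3 / 8 * t^2)) \<in> O[at 0](\<lambda>t::real. t^3)"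
    unfolding at_eq_sup_left_right by (intro landau_o.big.sup) real_asymp+
  then obtain C where C: "C > 0"
    "eventually (\<lambda>t::real. norm (1 / sqrt (1 + t) - (1 - t / 2 + 3 / 8 * t^2)) \<le> C * norm (t^3)) (at 0)"
    by (elim landau_o.bigE)
  then obtain \<delta> where \<delta>: "\<delta> > 0"
    "\<And>t. t \<noteq> 0 \<Longrightarrow> \<bar>t\<bar> < \<delta> \<Longrightarrow> norm (1 / sqrt (1 + t) - (1 - t / 2 + 3 / 8 * t^2)) \<le> C * norm (t^3)"
    unfolding eventually_at by (auto simp: dist_norm)
  have "\<bar>1 / sqrt (1 + t) - (1 - t / 2 + 3 / 8 * t^2)\<bar> \<le> C * \<bar>t\<bar>^3" if "\<bar>t\<bar> < \<delta>" for t :: real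
    using \<delta>(2)[of t] that by (cases "t = 0") (auto simp: power_abs)
  with \<delta>(1) C(1) show ?thesis by blast
qed

lemma bigo_power_mult:
  fixes f g r :: "'a \<Rightarrow> real"
  assumes "f \<in> O[F](\<lambda>z. r z ^ j)" "g \<in> O[F](\<lambda>z. r z ^ k)" "n \<le> j + k" "eventually (\<lambda>z. \<bar>r z\<bar> \<le> 1) F"
  shows "(\<lambda>z. f z * g z) \<in> O[F](\<lambda>z. r z ^ n)"
proof -
  have "(\<lambda>z. f z * g z) \<in> O[F](\<lambda>z. r z ^ j * r z ^ k)"
    by (rule landau_o.big.mult[OF assms(1,2)])
  also have "(\<lambda>z. r z ^ j * r z ^ k) \<in> O[F](\<lambda>z. r z ^ n)"
  proof (rule landau_o.bigI[where c = 1])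
    show "eventually (\<lambda>z. norm (r z ^ j * r z ^ k) \<le> 1 * norm (r z ^ n)) F"
      using assms(4)
      by eventually_elim
         (use assms(3) in \<open>auto simp: power_abs abs_mult power_add[symmetric] intro!: power_decreasing\<close>)
  qed simp
  finally show ?thesis .
qed

lemma bigo_power_mono:
  fixes f r :: "'a \<Rightarrow> real"
  assumes "f \<in> O[F](\<lambda>z. r z ^ j)" "n \<le> j" "eventually (\<lambda>z. \<bar>r z\<bar> \<le> 1) F"
  shows "f \<in> O[F](\<lambda>z. r z ^ n)"
  using bigo_power_mult[of f F r j "\<lambda>_. 1" 0 n] assms by simp

definition ratio2 :: "real \<Rightarrow> real" where "ratio2 h = nonlin2 h / nonlin1 h"
definition ratio3 :: "real \<Rightarrow> real" where "ratio3 h = nonlin3 h / nonlin1 h"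

text \<open>Only \<open>\<bar>u\<bar> \<le> r\<close> is assumed here. This crude form is what later
  yields \<open>u = O(r^2)\<close>, the hypothesis of the second-order expansion.\<close>

lemma dd_first_order:
  fixes h :: real
  assumes h: "h > 0" and d1: "nonlin1 h > 0"
  shows "\<exists>\<rho> C. 0 < \<rho> \<and> \<rho> < h / 4 \<and> \<rho> \<le> 1 \<and> C > 0 \<and> (\<forall>r u y. 0 < r \<and> r < \<rho> \<and> \<bar>u\<bar> \<le> r \<and> \<bar>y\<bar> \<le> r \<longrightarrow>
     \<bar>dd (h + u - r) (h + u + r) (h + u + y) / nonlin1 h - 1\<bar> \<le> C * r)"
proof -
  define C0 where "C0 = 8 * (3024 / (h/2)^10 + 360 / (h/2)^7)"
  have C0: "C0 > 0" unfolding C0_def using h by (auto intro!: add_pos_pos)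
  \<comment> \<open>With \<open>r \<le> 1\<close> all higher powers are absorbed into
    \<open>r\<close>; the factors 2 come from \<open>\<bar>u + y / 3\<bar> \<le> 2 * r\<close> and
    from half of the bound \<open>4 * r\<close> for the quadratic bracket.\<close>
  define C where "C = (C0 + 2 * \<bar>nonlin2 h\<bar> + 2 * \<bar>nonlin3 h\<bar>) / nonlin1 h"
  have C: "C > 0" using C0 d1 by (auto simp: C_def intro!: divide_pos_pos add_pos_nonneg)
  have "\<bar>dd (h + u - r) (h + u + r) (h + u + y) / nonlin1 h - 1\<bar> \<le> C * r"
    if H: "0 < r" "r < min 1 (h / 8)" "\<bar>u\<bar> \<le> r" "\<bar>y\<bar> \<le> r" for r u y
  proof -
    have r1: "r^2 \<le> r" "r^3 \<le> r" using H power_decreasing[of 1 2 r] power_decreasing[of 1 3 r] by auto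
    have "u^2 \<le> r^2" "y^2 \<le> r^2" "\<bar>u\<bar> * \<bar>y\<bar> \<le> r^2"
      using H power_mono[of "\<bar>u\<bar>" r 2] power_mono[of "\<bar>y\<bar>" r 2] mult_mono[of "\<bar>u\<bar>" r "\<bar>y\<bar>" r]
      by (auto simp: power2_eq_square)
    with r1(1) have u2: "u^2 \<le> r" "y^2 \<le> r" "\<bar>u * y\<bar> \<le> r"
      unfolding abs_mult by linarith+
    have "\<bar>dd (h + u - r) (h + u + r) (h + u + y) - dd_quad h u r y\<bar> \<le> C0 * r^3"
      unfolding C0_def using dd_expansion[OF h H(1) _ H(3,4)] H(2) h by simp
    also have "\<dots> \<le> C0 * r" using r1 C0 by simp
    finally have 1: "\<bar>dd (h + u - r) (h + u + r) (h + u + y) - dd_quad h u r y\<bar> \<le> C0 * r" .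
    have "\<bar>u + y / 3\<bar> \<le> 2 * r" using H by linarith
    then have 2: "\<bar>nonlin2 h * (u + y / 3)\<bar> \<le> 2 * \<bar>nonlin2 h\<bar> * r"
      using mult_left_mono[of "\<bar>u + y / 3\<bar>" "2 * r" "\<bar>nonlin2 h\<bar>"] by (simp add: abs_mult)
    have "\<bar>u^2 + 2 * u * y / 3 + (r^2 + y^2) / 6\<bar> \<le> 4 * r"
    proof -
      have "\<bar>p + 2 * s / 3 + (c + q) / 6\<bar> \<le> 4 * r"
        if "p \<le> r" "q \<le> r" "\<bar>s\<bar> \<le> r" "c \<le> r" "0 \<le> p" "0 \<le> q" "0 \<le> c" for p q s c :: real
        using that H(1) by (auto simp: abs_le_iff field_simps)
      from this[OF u2 r1(1)] show ?thesis by (simp add: mult.assoc)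
    qed
    then have 3: "\<bar>nonlin3 h / 2 * (u^2 + 2 * u * y / 3 + (r^2 + y^2) / 6)\<bar> \<le> 2 * \<bar>nonlin3 h\<bar> * r"
      using mult_left_mono[of "\<bar>u^2 + 2 * u * y / 3 + (r^2 + y^2) / 6\<bar>" "4 * r" "\<bar>nonlin3 h / 2\<bar>"]
      by (simp add: abs_mult mult_ac)
    have "\<bar>dd (h + u - r) (h + u + r) (h + u + y) - nonlin1 h\<bar> \<le> (C0 + 2 * \<bar>nonlin2 h\<bar> + 2 * \<bar>nonlin3 h\<bar>) * r"
      using 1 2 3 unfolding dd_quad_def distrib_right by linarith
    then have "\<bar>dd (h + u - r) (h + u + r) (h + u + y) - nonlin1 h\<bar> / nonlin1 h \<le> C * r"
      using d1 by (simp add: C_def divide_right_mono)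
    also have "\<bar>dd (h + u - r) (h + u + r) (h + u + y) - nonlin1 h\<bar> / nonlin1 h
        = \<bar>dd (h + u - r) (h + u + r) (h + u + y) / nonlin1 h - 1\<bar>"
    proof -
      have "X / d - 1 = (X - d) / d" if "d > 0" for X d :: real
        using that by (simp add: diff_divide_distrib)
      from this[OF d1] show ?thesis using d1 by simp
    qed
    finally show ?thesis .
  qed
  then show ?thesis using C h by (intro exI[of _ "min 1 (h / 8)"] exI[of _ C]) auto
qed

text \<open>On a phase orbit \<open>u + y\<close> is the deviation from the mean, so the weight does not change the
  integral over full turns; it is chosen to cancel the term linear in \<open>u\<close>.\<close>

lemma dd_second_order:
  fixes h :: real
  assumes h: "h > 0" and d1: "nonlin1 h > 0"
  shows "\<exists>\<rho> C. 0 < \<rho> \<and> C > 0 \<and> (\<forall>r u y. 0 < r \<and> r < \<rho> \<and> \<bar>u\<bar> \<le> K * r^2 \<and> \<bar>u\<bar> \<le> r \<and> \<bar>y\<bar> \<le> r \<longrightarrow>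
     \<bar>(1 + ratio2 h / 2 * (u + y)) * (sqrt (nonlin1 h) / sqrt (dd (h + u - r) (h + u + r) (h + u + y)))
       - (1 + ratio2 h / 3 * y - ratio3 h / 24 * r^2 - (ratio3 h + (ratio2 h)^2) / 24 * y^2)\<bar> \<le> C * r^3)"
proof -
  define R U Y :: "real \<times> real \<times> real \<Rightarrow> real" where "R z = fst z" "U z = fst (snd z)" "Y z = snd (snd z)" for z
  \<comment> \<open>Convergence along \<open>F\<close> means \<open>r\<close> tends to 0 from the
    right, uniformly over all \<open>u\<close>, \<open>y\<close> obeying the constraints. Estimates
    on triples thus become Landau symbols in powers of \<open>r\<close>.\<close>
  define F where "F = inf (filtercomap R (at_right 0)) (principal {z. \<bar>U z\<bar> \<le> K * R z^2 \<and> \<bar>U z\<bar> \<le> R z \<and> \<bar>Y z\<bar> \<le> R z})"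
  have evF: "eventually P F \<longleftrightarrow> (\<exists>\<rho>>0. \<forall>z. 0 < R z \<and> R z < \<rho> \<and> \<bar>U z\<bar> \<le> K * R z^2 \<and> \<bar>U z\<bar> \<le> R z \<and> \<bar>Y z\<bar> \<le> R z \<longrightarrow> P z)" for P
  proof
    assume "eventually P F"
    then obtain Q b where "b > 0" "\<forall>y>0. y < b \<longrightarrow> Q y" "\<And>z. Q (R z) \<Longrightarrow> \<bar>U z\<bar> \<le> K * R z^2 \<and> \<bar>U z\<bar> \<le> R z \<and> \<bar>Y z\<bar> \<le> R z \<Longrightarrow> P z"
      unfolding F_def eventually_inf_principal eventually_filtercomap eventually_at_right_field by blast
    then show "\<exists>\<rho>>0. \<forall>z. 0 < R z \<and> R z < \<rho> \<and> \<bar>U z\<bar> \<le> K * R z^2 \<and> \<bar>U z\<bar> \<le> R z \<and> \<bar>Y z\<bar> \<le> R z \<longrightarrow> P z"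
      by (intro exI[of _ b]) simp
  next
    assume "\<exists>\<rho>>0. \<forall>z. 0 < R z \<and> R z < \<rho> \<and> \<bar>U z\<bar> \<le> K * R z^2 \<and> \<bar>U z\<bar> \<le> R z \<and> \<bar>Y z\<bar> \<le> R z \<longrightarrow> P z"
    then obtain \<rho> where \<rho>: "\<rho> > 0" "\<And>z. 0 < R z \<and> R z < \<rho> \<and> \<bar>U z\<bar> \<le> K * R z^2 \<and> \<bar>U z\<bar> \<le> R z \<and> \<bar>Y z\<bar> \<le> R z \<Longrightarrow> P z"
      by blast
    then show "eventually P F"
      unfolding F_def eventually_inf_principal eventually_filtercomap eventually_at_right_field
      by (intro exI[of _ "\<lambda>r. 0 < r \<and> r < \<rho>"]) auto
  qed
  have R1: "eventually (\<lambda>z. \<bar>R z\<bar> \<le> 1) F"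
    unfolding evF by (intro exI[of _ 1]) auto
  have U: "U \<in> O[F](\<lambda>z. R z ^ 2)"
    by (rule landau_o.bigI[where c = "\<bar>K\<bar> + 1"])
       (auto simp: evF power_abs intro!: exI[of _ 1] elim!: order_trans mult_right_mono)
  have Y: "Y \<in> O[F](\<lambda>z. R z ^ 1)"
    by (rule landau_o.bigI[where c = 1]) (auto simp: evF intro!: exI[of _ 1])
  have R2: "(\<lambda>z. R z ^ n) \<in> O[F](\<lambda>z. R z ^ n)" for n by simp
  note mul = bigo_power_mult[OF _ _ _ R1]
  note mon = bigo_power_mono[OF _ _ R1]
  have con: "(\<lambda>z. c) \<in> O[F](\<lambda>z. R z ^ 0)" for c :: real by simp
  define D where "D z = dd (h + U z - R z) (h + U z + R z) (h + U z + Y z)" for z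
  define T where "T z = D z / nonlin1 h - 1" for z
  define T2 where "T2 z = dd_quad h (U z) (R z) (Y z) / nonlin1 h - 1" for z
  \<comment> \<open>The relative deviation \<open>T\<close> splits by order: \<open>L\<close> is of
    order one, \<open>W\<close> of order two, with its cubic part \<open>w\<close> kept separate,
    and \<open>s\<close> is the Taylor error of order three.\<close>
  define L where "L z = ratio2 h / 3 * Y z" for z
  define w where "w z = ratio3 h / 2 * (U z * U z + 2 / 3 * (U z * Y z))" for z
  define W where "W z = ratio2 h * U z + ratio3 h / 12 * (R z ^ 2 + Y z ^ 2) + w z" for z
  have T2: "T2 z = L z + W z" for z
    using d1 unfolding T2_def L_def W_def w_def dd_quad_def ratio2_def ratio3_def
    by (simp add: field_simps power2_eq_square)
  define s where "s z = T z - T2 z" for z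
  define C0 where "C0 = 8 * (3024 / (h/2)^10 + 360 / (h/2)^7)"
  have sO: "s \<in> O[F](\<lambda>z. R z ^ 3)"
  proof (rule landau_o.bigI[where c = "C0 / nonlin1 h"])
    show "C0 / nonlin1 h > 0" unfolding C0_def using h d1 by (auto intro!: divide_pos_pos add_pos_pos)
    show "eventually (\<lambda>z. norm (s z) \<le> C0 / nonlin1 h * norm (R z ^ 3)) F"
      unfolding evF
    proof (intro exI[of _ "h / 4"] conjI allI impI)
      fix z assume z: "0 < R z \<and> R z < h / 4 \<and> \<bar>U z\<bar> \<le> K * (R z)\<^sup>2 \<and> \<bar>U z\<bar> \<le> R z \<and> \<bar>Y z\<bar> \<le> R z"
      have "s z = (D z - dd_quad h (U z) (R z) (Y z)) / nonlin1 h"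
        by (simp add: s_def T_def T2_def diff_divide_distrib)
      moreover have "\<bar>D z - dd_quad h (U z) (R z) (Y z)\<bar> \<le> C0 * R z ^ 3"
        unfolding D_def C0_def using dd_expansion[OF h, of "R z" "U z" "Y z"] z by simp
      ultimately show "norm (s z) \<le> C0 / nonlin1 h * norm (R z ^ 3)"
        using d1 z by (simp add: divide_right_mono)
    qed (use h in auto)
  qed
  have LO: "L \<in> O[F](\<lambda>z. R z ^ 1)" unfolding L_def by (rule mul[OF con Y]) simp
  have wO: "w \<in> O[F](\<lambda>z. R z ^ 3)" unfolding w_def
    by (intro mul[OF con, of _ 3] sum_in_bigo mul[OF U U] mul[OF U Y]) simp_all
  have YY: "(\<lambda>z. Y z ^ 2) \<in> O[F](\<lambda>z. R z ^ 2)" unfolding power2_eq_square[of "Y _"] by (rule mul[OF Y Y]) simp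
  have WO: "W \<in> O[F](\<lambda>z. R z ^ 2)" unfolding W_def
    by (intro sum_in_bigo mul[OF con U] mul[OF con, of _ 2] mon[OF wO] R2 YY) simp_all
  have TO: "T \<in> O[F](\<lambda>z. R z ^ 1)"
  proof -
    have "T = (\<lambda>z. L z + W z + s z)" by (simp add: fun_eq_iff s_def T2)
    then show ?thesis using sum_in_bigo(1)[OF sum_in_bigo(1)[OF LO mon[OF WO]] mon[OF sO]] by simp
  qed
  define q where "q z = 1 / sqrt (1 + T z) - (1 - T z / 2 + 3 / 8 * T z ^ 2)" for z
  have qO: "q \<in> O[F](\<lambda>z. R z ^ 3)"
  proof -
    obtain \<delta> C where \<delta>: "\<delta> > 0" "C > 0"
      "\<And>t. \<bar>t\<bar> < \<delta> \<Longrightarrow> \<bar>1 / sqrt (1 + t) - (1 - t / 2 + 3 / 8 * t^2)\<bar> \<le> C * \<bar>t::real\<bar>^3"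
      using inverse_sqrt_expansion by blast
    from TO obtain c where c: "c > 0" "eventually (\<lambda>z. norm (T z) \<le> c * norm (R z ^ 1)) F"
      by (elim landau_o.bigE)
    have "eventually (\<lambda>z. R z < \<delta> / c \<and> R z > 0) F"
      unfolding evF using \<delta> c by (intro exI[of _ "\<delta> / c"]) auto
    with c(2) have "eventually (\<lambda>z. norm (q z) \<le> C * norm (T z ^ 3)) F"
    proof eventually_elim
      case (elim z)
      then have "c * R z < \<delta>" using c by (simp add: field_simps)
      with elim show ?case unfolding q_def using \<delta>(3)[of "T z"] by (simp add: power_abs)
    qed
    then have "q \<in> O[F](\<lambda>z. T z ^ 3)" using \<delta>(2) by (intro landau_o.bigI)
    also have "(\<lambda>z. T z ^ 3) \<in> O[F](\<lambda>z. R z ^ 3)"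
      using landau_o.big_power[OF TO, of 3] by simp
    finally show ?thesis .
  qed
  \<comment> \<open>What \<open>T^2\<close> contains beyond \<open>L^2\<close>: the square of
    \<open>L + W\<close> is expanded, and \<open>T^2 - T2^2 = s * (T + T2)\<close>.\<close>
  define t where "t z = 2 * (L z * W z) + W z * W z + s z * (T z + T2 z)" for z
  have T2O: "T2 \<in> O[F](\<lambda>z. R z ^ 1)"
    unfolding T2[abs_def] using sum_in_bigo(1)[OF LO mon[OF WO]] by simp
  have tO: "t \<in> O[F](\<lambda>z. R z ^ 3)"
    unfolding t_def
    by (intro sum_in_bigo mul[OF con, of _ 3] mul[OF LO WO] mul[OF WO WO] mul[OF sO sum_in_bigo(1)[OF TO T2O]]) simp_all
  define n where "n z = q z - 1/2 * s z + 3/8 * t z" for z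
  have nO: "n \<in> O[F](\<lambda>z. R z ^ 3)"
    unfolding n_def by (intro sum_in_bigo qO mul[OF con sO] mul[OF con tO]) simp_all
  have T2sq: "T z ^ 2 = L z ^ 2 + t z" for z
    unfolding t_def s_def T2 by (simp add: algebra_simps power2_eq_square)
  have G: "1 / sqrt (1 + T z) = 1 - 1/2 * L z - 1/2 * W z + 3/8 * (L z * L z) + n z" for z
  proof -
    have "1 / sqrt (1 + T z) = q z + (1 - T z / 2 + 3 / 8 * T z ^ 2)" by (simp add: q_def)
    also have "T z = L z + W z + s z" by (simp add: s_def T2)
    finally have "1 / sqrt (1 + T z) = q z + (1 - (L z + W z + s z) / 2 + 3 / 8 * (L z ^ 2 + t z))"
      using T2sq[of z] \<open>T z = L z + W z + s z\<close> by simp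
    then show ?thesis by (simp add: n_def field_simps power2_eq_square)
  qed
  \<comment> \<open>All products of order at least three. At order two the weight contributes
    \<open>ratio2 h / 2 * U z\<close>, cancelling the same term of \<open>W z / 2\<close>; the
    \<open>Y^2\<close> terms with \<open>ratio2 h ^ 2\<close> add up to
    \<open>1 / 24 - 1 / 12 = - 1 / 24\<close>.\<close>
  define E where "E z = n z * (1 + ratio2 h / 2 * (U z + Y z))
      + ratio2 h / 2 * (U z * (3/8 * (L z * L z) - 1/2 * L z - 1/2 * W z))
      + ratio2 h / 2 * (Y z * (3/8 * (L z * L z) - 1/2 * W z)) - 1/2 * w z" for z
  have "E \<in> O[F](\<lambda>z. R z ^ 3)"
  proof -
    have LL: "(\<lambda>z. 3/8 * (L z * L z)) \<in> O[F](\<lambda>z. R z ^ 2)" by (rule mul[OF con mul[OF LO LO, of 2]]) simp_all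
    have W': "(\<lambda>z. 1/2 * W z) \<in> O[F](\<lambda>z. R z ^ 2)" by (rule mul[OF con WO]) simp
    have L': "(\<lambda>z. 1/2 * L z) \<in> O[F](\<lambda>z. R z ^ 1)" by (rule mul[OF con LO]) simp
    have i1: "(\<lambda>z. 1 + ratio2 h / 2 * (U z + Y z)) \<in> O[F](\<lambda>z. R z ^ 0)"
      by (intro sum_in_bigo con mul[OF con, of _ 0] mon[OF U] mon[OF Y]) simp_all
    have i2: "(\<lambda>z. 3/8 * (L z * L z) - 1/2 * L z - 1/2 * W z) \<in> O[F](\<lambda>z. R z ^ 1)"
      by (rule sum_in_bigo(2)[OF sum_in_bigo(2)[OF mon[OF LL] L'] mon[OF W']]) simp_all
    have i3: "(\<lambda>z. 3/8 * (L z * L z) - 1/2 * W z) \<in> O[F](\<lambda>z. R z ^ 2)"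
      by (rule sum_in_bigo(2)[OF LL W'])
    have j1: "(\<lambda>z. n z * (1 + ratio2 h / 2 * (U z + Y z))) \<in> O[F](\<lambda>z. R z ^ 3)"
      by (rule mul[OF nO i1]) simp
    have j2: "(\<lambda>z. ratio2 h / 2 * (U z * (3/8 * (L z * L z) - 1/2 * L z - 1/2 * W z))) \<in> O[F](\<lambda>z. R z ^ 3)"
      by (rule mul[OF con mul[OF U i2, of 3]]) simp_all
    have j3: "(\<lambda>z. ratio2 h / 2 * (Y z * (3/8 * (L z * L z) - 1/2 * W z))) \<in> O[F](\<lambda>z. R z ^ 3)"
      by (rule mul[OF con mul[OF Y i3, of 3]]) simp_all
    have j4: "(\<lambda>z. 1/2 * w z) \<in> O[F](\<lambda>z. R z ^ 3)"
      by (rule mul[OF con wO]) simp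
    show ?thesis unfolding E_def
      by (rule sum_in_bigo(2)[OF sum_in_bigo(1)[OF sum_in_bigo(1)[OF j1 j2] j3] j4])
  qed
  then obtain C where C: "C > 0" "eventually (\<lambda>z. norm (E z) \<le> C * norm (R z ^ 3)) F"
    by (elim landau_o.bigE)
  have Eeq: "(1 + ratio2 h / 2 * (U z + Y z)) * (sqrt (nonlin1 h) / sqrt (D z))
       - (1 + ratio2 h / 3 * Y z - ratio3 h / 24 * R z^2 - (ratio3 h + (ratio2 h)^2) / 24 * Y z^2) = E z" for z
  proof -
    have eq: "sqrt (nonlin1 h) / sqrt (D z) = 1 / sqrt (1 + T z)"
      using d1 by (simp add: T_def real_sqrt_divide)
    show ?thesis unfolding eq G E_def unfolding W_def L_def
      by (simp add: field_simps power2_eq_square)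
  qed
  from C(2) obtain \<rho> where \<rho>: "\<rho> > 0" "\<And>z. 0 < R z \<and> R z < \<rho> \<and> \<bar>U z\<bar> \<le> K * R z^2 \<and> \<bar>U z\<bar> \<le> R z \<and> \<bar>Y z\<bar> \<le> R z \<Longrightarrow> norm (E z) \<le> C * norm (R z ^ 3)"
    unfolding evF by blast
  show ?thesis
  proof (rule exI[of _ \<rho>], rule exI[of _ C], intro conjI allI impI)
    fix r u y :: real assume H: "0 < r \<and> r < \<rho> \<and> \<bar>u\<bar> \<le> K * r\<^sup>2 \<and> \<bar>u\<bar> \<le> r \<and> \<bar>y\<bar> \<le> r"
    then have "norm (E (r, u, y)) \<le> C * norm (R (r, u, y) ^ 3)"
      by (intro \<rho>(2)) (auto simp: R_U_Y_def)
    then show "\<bar>(1 + ratio2 h / 2 * (u + y)) * (sqrt (nonlin1 h) / sqrt (dd (h + u - r) (h + u + r) (h + u + y)))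
       - (1 + ratio2 h / 3 * y - ratio3 h / 24 * r^2 - (ratio3 h + (ratio2 h)^2) / 24 * y^2)\<bar> \<le> C * r^3"
      unfolding Eeq[symmetric] using H by (simp add: R_U_Y_def D_def)
  qed (use \<rho> C in auto)
qed

section \<open>Integrals over full turns of the phase\<close>

lemma period_sin_cos:
  fixes \<alpha> :: real
  shows period_sin: "sin (\<alpha> + 2 * pi * real n) = sin \<alpha>"
    and period_cos: "cos (\<alpha> + 2 * pi * real n) = cos \<alpha>"
proof -
  have "2 * pi * real n = 2 * real n * pi" by simp
  then show "sin (\<alpha> + 2 * pi * real n) = sin \<alpha>" "cos (\<alpha> + 2 * pi * real n) = cos \<alpha>"
    by (simp_all only: sin_add cos_add sin_2npi cos_2npi mult_1_right mult_zero_right add_0_right diff_zero)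
qed

lemma has_integral_cos_period:
  "(cos has_integral 0) {\<alpha>..\<alpha> + 2 * pi * real n}"
proof -
  have "(cos has_integral (sin (\<alpha> + 2 * pi * real n) - sin \<alpha>)) {\<alpha>..\<alpha> + 2 * pi * real n}"
    by (intro fundamental_theorem_of_calculus)
       (auto simp flip: has_real_derivative_iff_has_vector_derivative intro!: derivative_eq_intros)
  then show ?thesis by (simp add: period_sin)
qed

lemma has_integral_cos2_period:
  "((\<lambda>x. cos x ^ 2) has_integral pi * real n) {\<alpha>..\<alpha> + 2 * pi * real n}"
proof -
  let ?F = "\<lambda>x. x / 2 + sin x * cos x / 2"
  have "((\<lambda>x. cos x ^ 2) has_integral (?F (\<alpha> + 2 * pi * real n) - ?F \<alpha>)) {\<alpha>..\<alpha> + 2 * pi * real n}"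
  proof (rule fundamental_theorem_of_calculus)
    fix x :: real
    have "(?F has_real_derivative (1 / 2 + (cos x * cos x - sin x * sin x) / 2)) (at x within {\<alpha>..\<alpha> + 2 * pi * real n})"
      by (auto intro!: derivative_eq_intros)
    also have "1 / 2 + (cos x * cos x - sin x * sin x) / 2 = cos x ^ 2"
      using sin_cos_squared_add[of x] by (simp add: power2_eq_square field_simps)
    finally show "(?F has_vector_derivative cos x ^ 2) (at x within {\<alpha>..\<alpha> + 2 * pi * real n})"
      by (simp add: has_real_derivative_iff_has_vector_derivative)
  qed simp
  also have "?F (\<alpha> + 2 * pi * real n) - ?F \<alpha> = pi * real n"
    unfolding period_sin period_cos by (simp add: add_divide_distrib)
  finally show ?thesis .
qed

text \<open>Along a solution written as \<open>m + r * cos \<phi>\<close>, the phase has derivative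
  \<open>speed m r \<phi> / \<epsilon>\<close>.\<close>

definition speed :: "real \<Rightarrow> real \<Rightarrow> real \<Rightarrow> real" where
  "speed m r \<phi> = sqrt (dd (m - r) (m + r) (m + r * cos \<phi>))"

lemma cos_bound: "(r::real) \<ge> 0 \<Longrightarrow> \<bar>r * cos \<phi>\<bar> \<le> r"
  by (simp add: abs_mult mult_left_le)

lemma cos_bound': "(r::real) \<ge> 0 \<Longrightarrow> m - r \<le> m + r * cos \<phi> \<and> m + r * cos \<phi> \<le> m + r"
  using cos_bound[of r \<phi>] by (simp add: abs_le_iff)

lemma continuous_on_speed: "0 \<le> r \<Longrightarrow> r < m \<Longrightarrow> continuous_on S (speed m r)"
  unfolding speed_def using cos_bound'[of r m]
  by (intro continuous_intros continuous_on_dd) (auto intro: less_le_trans[of 0 "m - r"])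

lemma integral_error_bound:
  fixes g p :: "real \<Rightarrow> real"
  assumes "continuous_on {a..b} g" "(p has_integral P) {a..b}" "a \<le> b"
    and "\<And>x. x \<in> {a..b} \<Longrightarrow> \<bar>g x - p x\<bar> \<le> e"
  shows "\<bar>integral {a..b} g - P\<bar> \<le> e * (b - a)"
proof -
  have g: "(g has_integral integral {a..b} g) {a..b}"
    using assms(1) by (simp add: integrable_continuous_real integrable_integral)
  have e: "e \<ge> 0" using assms(4)[of a] assms(3) by auto
  from has_integral_bound[OF e, of "\<lambda>x. g x - p x" "integral {a..b} g - P" a b]
    has_integral_diff[OF g assms(2)] assms(3,4)
  show ?thesis by simp
qed

text \<open>The coefficient \<open>\<kappa>\<close> of the overview, with \<open>f''\<close> and
  \<open>f'''\<close> divided by \<open>f'\<close>.\<close>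

definition branch_coeff :: "real \<Rightarrow> real" where "branch_coeff h = - (3 * ratio3 h + ratio2 h ^ 2) / 48"

text \<open>With \<open>s = sqrt (1 + t)\<close>, where \<open>t\<close> is the relative error of
  \<open>dd\<close>, one has \<open>1 / s - 1 = - t / (s * (1 + s))\<close>. A bound
  \<open>\<bar>t\<bar> \<le> 1 / 4\<close> gives \<open>s \<ge> 1 / 2\<close>, so the inverse root
  deviates by at most \<open>2 * \<bar>t\<bar>\<close>.\<close>

lemma speed_first_order:
  fixes h :: real
  assumes h: "h > 0" and d1: "nonlin1 h > 0"
  shows "\<exists>\<rho> C. 0 < \<rho> \<and> \<rho> < h / 4 \<and> C > 0 \<and> (\<forall>r m x. 0 < r \<and> r < \<rho> \<and> \<bar>m - h\<bar> \<le> r \<and> \<bar>x - m\<bar> \<le> r \<longrightarrow>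
     dd (m - r) (m + r) x > 0 \<and> \<bar>dd (m - r) (m + r) x - nonlin1 h\<bar> \<le> C * r \<and>
     \<bar>sqrt (nonlin1 h) / sqrt (dd (m - r) (m + r) x) - 1\<bar> \<le> C * r \<and> C * r \<le> 1 / 2)"
proof -
  from dd_first_order[OF h d1] obtain \<rho> C where \<rho>: "0 < \<rho>" "\<rho> < h / 4" "\<rho> \<le> 1" "C > 0"
    "\<And>r u y. 0 < r \<Longrightarrow> r < \<rho> \<Longrightarrow> \<bar>u\<bar> \<le> r \<Longrightarrow> \<bar>y\<bar> \<le> r \<Longrightarrow>
       \<bar>dd (h + u - r) (h + u + r) (h + u + y) / nonlin1 h - 1\<bar> \<le> C * r" by blast
  \<comment> \<open>\<open>2 * C\<close> serves the inverse root and \<open>C * nonlin1 h\<close>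
    the absolute error of \<open>dd\<close>. The radius below ensures
    \<open>C' * r \<le> 1 / 2\<close>, hence \<open>\<bar>t\<bar> \<le> 1 / 4\<close>.\<close>
  define C' where "C' = max (2 * C) (C * nonlin1 h)"
  have C': "C' > 0" "C' \<ge> 2 * C" "C' \<ge> C * nonlin1 h" using \<rho> by (auto simp: C'_def)
  define \<rho>' where "\<rho>' = min \<rho> (1 / (2 * C'))"
  have \<rho>': "0 < \<rho>'" "\<rho>' \<le> \<rho>" "\<rho>' < h / 4" using \<rho> C' by (auto simp: \<rho>'_def)
  have main: "dd (m - r) (m + r) x > 0 \<and> \<bar>dd (m - r) (m + r) x - nonlin1 h\<bar> \<le> C' * r \<and>
     \<bar>sqrt (nonlin1 h) / sqrt (dd (m - r) (m + r) x) - 1\<bar> \<le> C' * r \<and> C' * r \<le> 1 / 2"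
    if H: "0 < r" "r < \<rho>'" "\<bar>m - h\<bar> \<le> r" "\<bar>x - m\<bar> \<le> r" for r m x
  proof -
    define t where "t = dd (m - r) (m + r) x / nonlin1 h - 1"
    have Cr: "C' * r \<le> 1 / 2" using H C' unfolding \<rho>'_def by (simp add: field_simps)
    have "2 * C * r \<le> C' * r" using C' H by (intro mult_right_mono) auto
    have t: "\<bar>t\<bar> \<le> C * r" unfolding t_def using \<rho>(5)[of r "m - h" "x - m"] H \<rho>' by simp
    have t4: "\<bar>t\<bar> \<le> 1 / 4" using t Cr \<open>2 * C * r \<le> C' * r\<close> by linarith
    have d: "dd (m - r) (m + r) x = nonlin1 h * (1 + t)" unfolding t_def using d1 by (simp add: field_simps)
    have pos: "dd (m - r) (m + r) x > 0" unfolding d using d1 t4 by (intro mult_pos_pos) (auto simp: abs_le_iff)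
    have "\<bar>dd (m - r) (m + r) x - nonlin1 h\<bar> = nonlin1 h * \<bar>t\<bar>" unfolding d using d1 by (simp add: algebra_simps abs_mult)
    also have "\<dots> \<le> nonlin1 h * (C * r)" using t d1 by (intro mult_left_mono) auto
    also have "\<dots> \<le> C' * r" using C'(3) H mult_right_mono[of "C * nonlin1 h" C' r] by (simp add: mult_ac)
    finally have 2: "\<bar>dd (m - r) (m + r) x - nonlin1 h\<bar> \<le> C' * r" .
    define s where "s = sqrt (1 + t)"
    have s2: "s^2 = 1 + t" "s > 0" using t4 by (auto simp: s_def abs_le_iff)
    have "s \<ge> 1 / 2"
    proof (rule ccontr)
      assume "\<not> s \<ge> 1 / 2"
      then have "s * s \<le> 1 / 2 * (1 / 2)" using s2 by (intro mult_mono) auto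
      then show False using s2 t4 by (simp add: power2_eq_square)
    qed
    have "1 / s - 1 = - t / (s * (1 + s))"
    proof -
      have t: "t = (s - 1) * (s + 1)" using s2 by (simp add: algebra_simps power2_eq_square)
      show ?thesis unfolding t using s2 by (simp add: divide_simps) (simp add: algebra_simps)
    qed
    then have "\<bar>1 / s - 1\<bar> = \<bar>t\<bar> / (s * (1 + s))" using s2 by (simp add: abs_mult)
    also have "\<dots> \<le> \<bar>t\<bar> / (1 / 2)"
    proof (rule divide_left_mono)
      show "1 / 2 \<le> s * (1 + s)" using \<open>s \<ge> 1/2\<close> mult_mono[of "1/2" s 1 "1 + s"] by simp
    qed (use s2 in auto)
    also have "\<dots> \<le> C' * r" using t \<open>2 * C * r \<le> C' * r\<close> by simp
    also have "1 / s = sqrt (nonlin1 h) / sqrt (dd (m - r) (m + r) x)"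
      unfolding d s_def using d1 by (simp add: real_sqrt_mult)
    finally show ?thesis using pos 2 Cr by blast
  qed
  show ?thesis
    by (rule exI[of _ \<rho>'], rule exI[of _ C']) (use main \<rho>' C' in blast)
qed

text \<open>The first-order estimate holds for every centre within \<open>r\<close> of
  \<open>h\<close>. The mean condition does two things for the second-order one: it forces
  \<open>m - h = O(r^2)\<close>, and it allows the weight from the pointwise expansion to be
  inserted at no cost. The starting phase \<open>\<alpha>\<close> is free because a given solution
  may start anywhere on its orbit.\<close>

lemma period_estimate:
  fixes h :: real
  assumes h: "h > 0" and d1: "nonlin1 h > 0"
  obtains \<rho> C where
    "0 < \<rho>" "\<rho> < h / 4" "C > 0"
    "\<And>r m x. 0 < r \<Longrightarrow> r < \<rho> \<Longrightarrow> \<bar>m - h\<bar> \<le> r \<Longrightarrow> \<bar>x - m\<bar> \<le> r \<Longrightarrow>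
       dd (m - r) (m + r) x > 0 \<and> \<bar>dd (m - r) (m + r) x - nonlin1 h\<bar> \<le> C * r"
    "\<And>r m \<alpha> n. 0 < r \<Longrightarrow> r < \<rho> \<Longrightarrow> \<bar>m - h\<bar> \<le> r \<Longrightarrow>
       \<bar>sqrt (nonlin1 h) * integral {\<alpha>..\<alpha> + 2 * pi * real n} (\<lambda>\<phi>. 1 / speed m r \<phi>) - 2 * pi * real n\<bar>
         \<le> C * r * (2 * pi * real n)"
    "\<And>r m \<alpha> n. 0 < r \<Longrightarrow> r < \<rho> \<Longrightarrow> \<bar>m - h\<bar> \<le> r \<Longrightarrow> n > 0 \<Longrightarrow>
       integral {\<alpha>..\<alpha> + 2 * pi * real n} (\<lambda>\<phi>. (m - h + r * cos \<phi>) / speed m r \<phi>) = 0 \<Longrightarrow>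
       \<bar>sqrt (nonlin1 h) * integral {\<alpha>..\<alpha> + 2 * pi * real n} (\<lambda>\<phi>. 1 / speed m r \<phi>)
         - 2 * pi * real n * (1 + branch_coeff h * r^2)\<bar> \<le> C * r^3 * (2 * pi * real n)"
proof -
  from speed_first_order[OF h d1] obtain \<rho>1 C1 where 1: "0 < \<rho>1" "\<rho>1 < h / 4" "C1 > 0"
    "\<And>r m x. 0 < r \<Longrightarrow> r < \<rho>1 \<Longrightarrow> \<bar>m - h\<bar> \<le> r \<Longrightarrow> \<bar>x - m\<bar> \<le> r \<Longrightarrow>
     dd (m - r) (m + r) x > 0 \<and> \<bar>dd (m - r) (m + r) x - nonlin1 h\<bar> \<le> C1 * r \<and>
     \<bar>sqrt (nonlin1 h) / sqrt (dd (m - r) (m + r) x) - 1\<bar> \<le> C1 * r \<and> C1 * r \<le> 1 / 2" by blast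
  \<comment> \<open>\<open>2 * C1\<close> is the bound on \<open>\<bar>m - h\<bar> / r^2\<close>
    that the mean condition will give.\<close>
  from dd_second_order[OF h d1, of "2 * C1"] obtain \<rho>2 C2 where 2: "0 < \<rho>2" "C2 > 0"
    "\<And>r u y. 0 < r \<Longrightarrow> r < \<rho>2 \<Longrightarrow> \<bar>u\<bar> \<le> 2 * C1 * r^2 \<Longrightarrow> \<bar>u\<bar> \<le> r \<Longrightarrow> \<bar>y\<bar> \<le> r \<Longrightarrow>
     \<bar>(1 + ratio2 h / 2 * (u + y)) * (sqrt (nonlin1 h) / sqrt (dd (h + u - r) (h + u + r) (h + u + y)))
       - (1 + ratio2 h / 3 * y - ratio3 h / 24 * r^2 - (ratio3 h + (ratio2 h)^2) / 24 * y^2)\<bar> \<le> C2 * r^3"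
    by blast
  define \<rho> C where "\<rho> = min \<rho>1 \<rho>2" "C = max C1 C2"
  have C: "C > 0" "C1 \<le> C" "C2 \<le> C" using 1 2 by (auto simp: \<rho>_C_def)
  have A: "dd (m - r) (m + r) x > 0 \<and> \<bar>dd (m - r) (m + r) x - nonlin1 h\<bar> \<le> C * r"
    if "0 < r" "r < \<rho>" "\<bar>m - h\<bar> \<le> r" "\<bar>x - m\<bar> \<le> r" for r m x
  proof -
    have "C1 * r \<le> C * r" using C that by (intro mult_right_mono) auto
    moreover have "r < \<rho>1" using that by (simp add: \<rho>_C_def)
    ultimately show ?thesis using 1(4)[OF that(1) _ that(3,4)] by (meson order_trans)
  qed
  have B: "\<bar>sqrt (nonlin1 h) * integral {\<alpha>..\<alpha> + 2 * pi * real n} (\<lambda>\<phi>. 1 / speed m r \<phi>) - 2 * pi * real n\<bar>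
         \<le> C * r * (2 * pi * real n) \<and>
       (n > 0 \<and> integral {\<alpha>..\<alpha> + 2 * pi * real n} (\<lambda>\<phi>. (m - h + r * cos \<phi>) / speed m r \<phi>) = 0 \<longrightarrow>
         \<bar>sqrt (nonlin1 h) * integral {\<alpha>..\<alpha> + 2 * pi * real n} (\<lambda>\<phi>. 1 / speed m r \<phi>)
             - 2 * pi * real n * (1 + branch_coeff h * r^2)\<bar> \<le> C * r^3 * (2 * pi * real n))"
    if H: "0 < r" "r < \<rho>" "\<bar>m - h\<bar> \<le> r" for r m \<alpha> and n :: nat
  proof -
    define b where "b = \<alpha> + 2 * pi * real n"
    have ab: "\<alpha> \<le> b" "b - \<alpha> = 2 * pi * real n" by (auto simp: b_def)
    have r1: "r < \<rho>1" "r < \<rho>2" using H by (auto simp: \<rho>_C_def)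
    define G where "G \<phi> = sqrt (nonlin1 h) / speed m r \<phi>" for \<phi>
    have rm: "r < m" using H r1 1 by (auto simp: abs_le_iff)
    have pos: "speed m r \<phi> > 0" for \<phi>
      unfolding speed_def using A[of r m "m + r * cos \<phi>"] H cos_bound[of r \<phi>] by simp
    have G1: "\<bar>G \<phi> - 1\<bar> \<le> C1 * r" "C1 * r \<le> 1 / 2" for \<phi>
      unfolding G_def speed_def using 1(4)[of r m "m + r * cos \<phi>"] H r1 cos_bound[of r \<phi>] by auto
    have cG: "continuous_on {\<alpha>..b} G"
      unfolding G_def using pos H rm by (intro continuous_intros continuous_on_speed) (auto simp: less_imp_neq[symmetric] intro: less_imp_neq)
    have iG: "integral {\<alpha>..b} G = sqrt (nonlin1 h) * integral {\<alpha>..b} (\<lambda>\<phi>. 1 / speed m r \<phi>)"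
      unfolding G_def by (subst integral_mult_right[symmetric]) (simp add: field_simps)
    have one: "((\<lambda>_. 1::real) has_integral (2 * pi * real n)) {\<alpha>..b}"
      using has_integral_const_real[of "1::real" \<alpha> b] ab by simp
    have co: "(cos has_integral 0) {\<alpha>..b}" unfolding b_def by (rule has_integral_cos_period)
    have co2: "((\<lambda>x. cos x ^ 2) has_integral pi * real n) {\<alpha>..b}" unfolding b_def by (rule has_integral_cos2_period)
    have first: "\<bar>integral {\<alpha>..b} G - 2 * pi * real n\<bar> \<le> C1 * r * (2 * pi * real n)"
      using integral_error_bound[OF cG one ab(1) G1(1)] ab by simp
    have second: "\<bar>integral {\<alpha>..b} G - 2 * pi * real n * (1 + branch_coeff h * r^2)\<bar> \<le> C2 * r^3 * (2 * pi * real n)"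
      if n: "n > 0" and J: "integral {\<alpha>..b} (\<lambda>\<phi>. (m - h + r * cos \<phi>) / speed m r \<phi>) = 0"
    proof -
      define u where "u = m - h"
      have cont: "continuous_on {\<alpha>..b} (\<lambda>\<phi>. f \<phi> * G \<phi>)" if "continuous_on {\<alpha>..b} f" for f
        by (intro continuous_intros that cG)
      have J': "integral {\<alpha>..b} (\<lambda>\<phi>. (u + r * cos \<phi>) * G \<phi>) = 0"
      proof -
        have "(\<lambda>\<phi>. (u + r * cos \<phi>) * G \<phi>) = (\<lambda>\<phi>. sqrt (nonlin1 h) * ((m - h + r * cos \<phi>) / speed m r \<phi>))"
          by (simp add: G_def u_def fun_eq_iff)
        then show ?thesis by (simp only: integral_mult_right J mult_zero_right)
      qed
      have N: "2 * pi * real n > 0" using n by simp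
      \<comment> \<open>The mean condition reads
        \<open>u * \<integral> G = - r * \<integral> cos * G\<close>. Since the cosine integrates to
        zero and \<open>G\<close> is within \<open>C1 * r\<close> of 1, the right side is
        \<open>O(r^2)\<close>, while \<open>\<integral> G\<close> is at least half the length of the
        interval.\<close>
      have uK: "\<bar>u\<bar> \<le> 2 * C1 * r^2"
      proof -
        have i1: "G integrable_on {\<alpha>..b}" "(\<lambda>\<phi>. cos \<phi> * G \<phi>) integrable_on {\<alpha>..b}"
          using cG cont[of cos] by (auto intro!: integrable_continuous_real continuous_intros)
        have "(\<lambda>\<phi>. (u + r * cos \<phi>) * G \<phi>) = (\<lambda>\<phi>. u * G \<phi> + r * (cos \<phi> * G \<phi>))"
          by (simp add: fun_eq_iff algebra_simps)
        then have "0 = u * integral {\<alpha>..b} G + r * integral {\<alpha>..b} (\<lambda>\<phi>. cos \<phi> * G \<phi>)"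
          using J' i1 by (simp add: integral_add integrable_on_mult_right)
        then have "\<bar>u\<bar> * \<bar>integral {\<alpha>..b} G\<bar> = r * \<bar>integral {\<alpha>..b} (\<lambda>\<phi>. cos \<phi> * G \<phi>)\<bar>"
          using H by (metis abs_minus_cancel abs_mult abs_of_pos add_eq_0_iff)
        also have "\<bar>integral {\<alpha>..b} (\<lambda>\<phi>. cos \<phi> * G \<phi>) - 0\<bar> \<le> C1 * r * (b - \<alpha>)"
        proof (rule integral_error_bound[OF cont[of cos] co ab(1)])
          show "\<bar>cos x * G x - cos x\<bar> \<le> C1 * r" for x
          proof -
            have "\<bar>cos x * G x - cos x\<bar> = \<bar>cos x\<bar> * \<bar>G x - 1\<bar>" by (simp add: algebra_simps flip: abs_mult)
            also have "\<dots> \<le> 1 * (C1 * r)" using G1 by (intro mult_mono) auto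
            finally show ?thesis by simp
          qed
        qed (auto intro: continuous_intros)
        then have "r * \<bar>integral {\<alpha>..b} (\<lambda>\<phi>. cos \<phi> * G \<phi>)\<bar> \<le> r * (C1 * r * (2 * pi * real n))"
          using H ab by (intro mult_left_mono) auto
        finally have a: "\<bar>u\<bar> * \<bar>integral {\<alpha>..b} G\<bar> \<le> C1 * r^2 * (2 * pi * real n)"
          by (simp add: power2_eq_square algebra_simps)
        have "C1 * r * (2 * pi * real n) \<le> 1 / 2 * (2 * pi * real n)"
          by (rule mult_right_mono) (use G1(2) N in auto)
        then have "1 / 2 * (2 * pi * real n) \<le> \<bar>integral {\<alpha>..b} G\<bar>" using first by linarith
        then have "\<bar>u\<bar> * (1 / 2 * (2 * pi * real n)) \<le> \<bar>u\<bar> * \<bar>integral {\<alpha>..b} G\<bar>" by (rule mult_left_mono) simp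
        also note a
        finally have "\<bar>u\<bar> / 2 * (2 * pi * real n) \<le> C1 * r^2 * (2 * pi * real n)" by (simp only: mult_ac times_divide_eq_left times_divide_eq_right mult_1_left mult_1_right)
        then have "\<bar>u\<bar> / 2 \<le> C1 * r^2" using N by (simp only: mult_le_cancel_right_pos)
        then show ?thesis by simp
      qed
      let ?p = "\<lambda>\<phi>. (1 - ratio3 h / 24 * r^2) * 1 + ratio2 h / 3 * r * cos \<phi> - (ratio3 h + (ratio2 h)^2) / 24 * r^2 * cos \<phi> ^ 2"
      have ip: "(?p has_integral ((1 - ratio3 h / 24 * r^2) * (2 * pi * real n) + ratio2 h / 3 * r * 0 - (ratio3 h + (ratio2 h)^2) / 24 * r^2 * (pi * real n))) {\<alpha>..b}"
        by (intro has_integral_diff has_integral_add has_integral_mult_right one co co2)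
      have "\<bar>integral {\<alpha>..b} (\<lambda>\<phi>. (1 + ratio2 h / 2 * (u + r * cos \<phi>)) * G \<phi>) - ((1 - ratio3 h / 24 * r^2) * (2 * pi * real n) + ratio2 h / 3 * r * 0 - (ratio3 h + (ratio2 h)^2) / 24 * r^2 * (pi * real n))\<bar> \<le> C2 * r^3 * (b - \<alpha>)"
      proof (rule integral_error_bound[OF cont ip ab(1)])
        show "continuous_on {\<alpha>..b} (\<lambda>\<phi>. 1 + ratio2 h / 2 * (u + r * cos \<phi>))" by (intro continuous_intros)
        show "\<bar>(1 + ratio2 h / 2 * (u + r * cos x)) * G x - ?p x\<bar> \<le> C2 * r^3" for x
          using 2(3)[OF H(1) r1(2) uK, of "r * cos x"] H cos_bound[of r x]
          by (simp add: u_def G_def speed_def power_mult_distrib algebra_simps)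
      qed
      \<comment> \<open>The weight differs from 1 by a multiple of the deviation from the mean,
        whose integral against \<open>G\<close> vanishes.\<close>
      also have "integral {\<alpha>..b} (\<lambda>\<phi>. (1 + ratio2 h / 2 * (u + r * cos \<phi>)) * G \<phi>) = integral {\<alpha>..b} G"
      proof -
        have i: "G integrable_on {\<alpha>..b}" "(\<lambda>\<phi>. (u + r * cos \<phi>) * G \<phi>) integrable_on {\<alpha>..b}"
          by (auto intro!: integrable_continuous_real cG cont continuous_intros)
        have "(\<lambda>\<phi>. (1 + ratio2 h / 2 * (u + r * cos \<phi>)) * G \<phi>) = (\<lambda>\<phi>. G \<phi> + ratio2 h / 2 * ((u + r * cos \<phi>) * G \<phi>))"
          by (simp add: fun_eq_iff algebra_simps)
        then have "integral {\<alpha>..b} (\<lambda>\<phi>. (1 + ratio2 h / 2 * (u + r * cos \<phi>)) * G \<phi>)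
           = integral {\<alpha>..b} G + ratio2 h / 2 * integral {\<alpha>..b} (\<lambda>\<phi>. (u + r * cos \<phi>) * G \<phi>)"
          using i by (simp only: integral_add integral_mult_right integrable_on_mult_right)
        with J' show ?thesis by simp
      qed
      \<comment> \<open>\<open>cos^2\<close> has average \<open>1 / 2\<close>, so the coefficient of
        \<open>r^2\<close> is
        \<open>- ratio3 h / 24 - (ratio3 h + ratio2 h ^ 2) / 48\<close>.\<close>
      also have "(1 - ratio3 h / 24 * r^2) * (2 * pi * real n) + ratio2 h / 3 * r * 0 - (ratio3 h + (ratio2 h)^2) / 24 * r^2 * (pi * real n)
         = 2 * pi * real n * (1 + branch_coeff h * r^2)"
        unfolding branch_coeff_def by (simp add: field_simps)
      finally show ?thesis using ab by simp
    qed
    have Cr: "C1 * r * (2 * pi * real n) \<le> C * r * (2 * pi * real n)"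
      "C2 * r^3 * (2 * pi * real n) \<le> C * r^3 * (2 * pi * real n)"
      using C H by (auto intro!: mult_right_mono)
    show ?thesis unfolding b_def[symmetric] iG[symmetric]
      using order_trans[OF first Cr(1)] order_trans[OF second Cr(2)] by blast
  qed
  show ?thesis
  proof (rule that[of \<rho> C])
    show "0 < \<rho>" "\<rho> < h / 4" using 1 2 by (auto simp: \<rho>_C_def)
  qed (use A B C(1) in blast)+
qed

section \<open>From solutions to phases\<close>

lemma dx_eq:
  assumes "x \<in> {0..1}" "(u has_real_derivative d) (at x within {0..1})"
  shows "dx u x = d"
  unfolding dx_def using assms
  by (intro vector_derivative_within_closed_interval)
     (auto simp: has_real_derivative_iff_has_vector_derivative)

lemma dx_works:
  assumes "u differentiable_on {0..1}" "x \<in> {0..1}"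
  shows "(u has_real_derivative dx u x) (at x within {0..1})"
  unfolding dx_def has_real_derivative_iff_has_vector_derivative
  using assms vector_derivative_works[of u "at x within {0..1}"] by (auto simp: differentiable_on_def)

lemma C2I:
  assumes "\<And>x. x \<in> {0..1} \<Longrightarrow> (u has_real_derivative u1 x) (at x within {0..1})"
    and "\<And>x. x \<in> {0..1} \<Longrightarrow> (u1 has_real_derivative u2 x) (at x within {0..1})"
    and "continuous_on {0..1} u2"
  shows "u \<in> C2" "\<And>x. x \<in> {0..1} \<Longrightarrow> dx u x = u1 x" "\<And>x. x \<in> {0..1} \<Longrightarrow> dx (dx u) x = u2 x"
proof -
  show 1: "dx u x = u1 x" if "x \<in> {0..1}" for x using dx_eq[OF that assms(1)[OF that]] .
  have d: "(dx u has_real_derivative u2 x) (at x within {0..1})" if x: "x \<in> {0..1}" for x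
    by (rule has_field_derivative_transform_within[OF assms(2)[OF x], of 1]) (use x 1 in auto)
  show 2: "dx (dx u) x = u2 x" if "x \<in> {0..1}" for x using dx_eq[OF that d[OF that]] .
  have "u differentiable_on {0..1}" "dx u differentiable_on {0..1}"
    unfolding differentiable_on_def differentiable_def
    using assms(1) d unfolding has_field_derivative_def by blast+
  then show "u \<in> C2"
    using assms(3) 2 continuous_on_cong[of "{0..1}" "{0..1}" "dx (dx u)" u2] by (simp add: C2_def)
qed

lemma C2D:
  assumes "u \<in> C2"
  shows "\<And>x. x \<in> {0..1} \<Longrightarrow> (u has_real_derivative dx u x) (at x within {0..1})"
    "\<And>x. x \<in> {0..1} \<Longrightarrow> (dx u has_real_derivative dx (dx u) x) (at x within {0..1})"
    "continuous_on {0..1} u" "continuous_on {0..1} (dx u)" "continuous_on {0..1} (dx (dx u))"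
  using assms by (auto simp: C2_def intro: dx_works differentiable_imp_continuous_on)

lemma C2_norm_le:
  assumes "\<And>x. x \<in> {0..1} \<Longrightarrow> \<bar>u x\<bar> \<le> A" "\<And>x. x \<in> {0..1} \<Longrightarrow> \<bar>dx u x\<bar> \<le> B"
    "\<And>x. x \<in> {0..1} \<Longrightarrow> \<bar>dx (dx u) x\<bar> \<le> D"
  shows "C2_norm u \<le> A + B + D"
  unfolding C2_norm_def by (intro add_mono cSUP_least) (use assms in auto)

lemma C2_norm_ge:
  assumes "u \<in> C2" "x \<in> {0..1}"
  shows "\<bar>u x\<bar> \<le> C2_norm u"
proof -
  have bdd: "bdd_above ((\<lambda>x. \<bar>g x\<bar>) ` {0..1})" if "continuous_on {0..1} g" for g :: "real \<Rightarrow> real"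
    by (intro bounded_imp_bdd_above compact_imp_bounded compact_continuous_image continuous_intros that compact_Icc)
  have le: "\<bar>g y\<bar> \<le> (SUP x\<in>{0..1}. \<bar>g x\<bar>)" if "continuous_on {0..1} g" "y \<in> {0..1}" for g :: "real \<Rightarrow> real" and y
    by (rule cSUP_upper[OF that(2) bdd[OF that(1)]])
  show ?thesis
    unfolding C2_norm_def using le[OF C2D(3)[OF assms(1)] assms(2)] le[OF C2D(4)[OF assms(1)] assms(2)]
      le[OF C2D(5)[OF assms(1)] assms(2)] by linarith
qed

lemma C2_diff_const:
  assumes "u \<in> C2"
  shows "(\<lambda>x. u x - c) \<in> C2"
    "\<And>x. x \<in> {0..1} \<Longrightarrow> dx (\<lambda>x. u x - c) x = dx u x"
    "\<And>x. x \<in> {0..1} \<Longrightarrow> dx (dx (\<lambda>x. u x - c)) x = dx (dx u) x"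
proof -
  have 1: "((\<lambda>x. u x - c) has_real_derivative dx u x) (at x within {0..1})" if "x \<in> {0..1}" for x
    using C2D(1)[OF assms that] by (auto intro!: derivative_eq_intros)
  show "(\<lambda>x. u x - c) \<in> C2"
    "\<And>x. x \<in> {0..1} \<Longrightarrow> dx (\<lambda>x. u x - c) x = dx u x"
    "\<And>x. x \<in> {0..1} \<Longrightarrow> dx (dx (\<lambda>x. u x - c)) x = dx (dx u) x"
    using C2I[OF 1 C2D(2)[OF assms] C2D(5)[OF assms]] by auto
qed

text \<open>A maximum has right derivative at most 0 and left derivative at least 0. If it sits at
  an end point, periodicity makes both end points maxima; each supplies one inequality, and the two
  derivatives agree.\<close>

lemma periodic_max_derivative_zero:
  fixes u u' :: "real \<Rightarrow> real"
  assumes d: "\<And>x. x \<in> {0..1} \<Longrightarrow> (u has_real_derivative u' x) (at x within {0..1})"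
    and per: "u 0 = u 1" "u' 0 = u' 1"
    and x: "x \<in> {0..1}" and max: "\<And>y. y \<in> {0..1} \<Longrightarrow> u y \<le> u x"
  shows "u' x = 0"
proof -
  have le: "u' z \<le> 0" if z: "z \<in> {0..<1}" "u z = u x" for z
  proof (rule ccontr)
    assume "\<not> u' z \<le> 0"
    then obtain e where e: "e > 0" "\<And>k. 0 < k \<Longrightarrow> z + k \<in> {0..1} \<Longrightarrow> k < e \<Longrightarrow> u z < u (z + k)"
      using has_real_derivative_pos_inc_right[OF d[of z]] z by auto
    define k where "k = min (e / 2) (1 - z)"
    have k: "0 < k" "k < e" "z + k \<in> {0..1}" using e z by (auto simp: k_def min_def)
    show False using e(2)[OF k(1,3,2)] max[OF k(3)] z by simp
  qed
  have ge: "u' z \<ge> 0" if z: "z \<in> {0<..1}" "u z = u x" for z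
  proof (rule ccontr)
    assume "\<not> u' z \<ge> 0"
    then obtain e where e: "e > 0" "\<And>k. 0 < k \<Longrightarrow> z - k \<in> {0..1} \<Longrightarrow> k < e \<Longrightarrow> u z < u (z - k)"
      using has_real_derivative_neg_dec_left[OF d[of z]] z by auto
    define k where "k = min (e / 2) z"
    have k: "0 < k" "k < e" "z - k \<in> {0..1}" using e z by (auto simp: k_def min_def)
    show False using e(2)[OF k(1,3,2)] max[OF k(3)] z by simp
  qed
  consider "x = 0" | "x = 1" | "x \<in> {0<..<1}" using x by force
  then show ?thesis
  proof cases
    case 1 then show ?thesis using le[of 0] ge[of 1] per by simp
  next
    case 2 then show ?thesis using le[of 0] ge[of 1] per by simp
  next
    case 3 then show ?thesis using le[of x] ge[of x] by simp
  qed
qed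

section \<open>Energy, force and turning points of a solution\<close>

text \<open>Kept as a \<open>deriv\<close>: its value enters only through the force identity and
  cancels in the phase equations.\<close>

definition ddx :: "real \<Rightarrow> real \<Rightarrow> real \<Rightarrow> real" where
  "ddx a b x = deriv (dd a b) x"

lemma dd_deriv:
  assumes "x > 0"
  shows "(dd a b has_real_derivative ddx a b x) (at x)"
proof -
  have "\<exists>D. (dd a b has_real_derivative D) (at x)"
    unfolding dd_def[abs_def] dd_inv_def using assms
    by (intro exI) (rule derivative_eq_intros refl | simp)+
  then show ?thesis unfolding ddx_def by (metis DERIV_imp_deriv)
qed

definition slope :: "real \<Rightarrow> real \<Rightarrow> real" where
  "slope a b = (prim b - prim a) / (b - a)"

text \<open>\<open>prim x - slope a b * x\<close> takes equal values at \<open>a\<close> and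
  \<open>b\<close>, so its drop from there has the factors \<open>b - x\<close> and
  \<open>x - a\<close>; the linear term leaves the divided difference unchanged.\<close>

lemma energy_identity:
  assumes "a > 0" "a < b" "x > 0"
  shows "2 * (prim a - slope a b * a - (prim x - slope a b * x)) = (b - x) * (x - a) * dd a b x"
proof -
  have "slope a b * (b - a) = prim b - prim a" using assms by (simp add: slope_def)
  then have "(b - a) * (2 * (prim a - slope a b * a - (prim x - slope a b * x)))
      = 2 * (prim a * (b - x) + prim b * (x - a) - prim x * (b - a))" by algebra
  also have "\<dots> = (b - a) * ((b - x) * (x - a) * dd a b x)"
    using dd_identity[of a b x] assms by (simp add: mult.assoc)
  finally show ?thesis using assms by simp
qed

text \<open>The energy identity holds on the open half-line, so it may be differentiated in
  \<open>x\<close>.\<close>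

lemma force_identity:
  assumes "a > 0" "a < b" "x > 0"
  shows "- 2 * (nonlin x - slope a b) = (a + b - 2 * x) * dd a b x + (b - x) * (x - a) * ddx a b x"
proof -
  let ?L = "\<lambda>x. 2 * (prim a - slope a b * a - (prim x - slope a b * x))"
  let ?R = "\<lambda>x. (b - x) * (x - a) * dd a b x"
  have "(?L has_real_derivative - 2 * (nonlin x - slope a b)) (at x)"
    using prim_deriv[OF assms(3)] by (auto intro!: derivative_eq_intros)
  moreover have "(?R has_real_derivative (a + b - 2 * x) * dd a b x + (b - x) * (x - a) * ddx a b x) (at x)"
    using dd_deriv[OF assms(3), of a b] by (auto intro!: derivative_eq_intros simp: algebra_simps)
  then have "(?L has_real_derivative (a + b - 2 * x) * dd a b x + (b - x) * (x - a) * ddx a b x) (at x)"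
    by (rule has_field_derivative_transform_within_open[of _ _ _ "{0<..}"])
       (use assms energy_identity[OF assms(1,2)] in auto)
  ultimately show ?thesis by (rule DERIV_unique)
qed

text \<open>Energy conservation between a minimum and a maximum point, where the derivative vanishes
  by periodicity. The mean \<open>hbar\<close> lies between the two extreme values, which places
  \<open>m\<close> within \<open>r\<close> of it.\<close>

lemma solution_turning_points:
  assumes nt: "nontrivial_solution hbar \<epsilon> w"
  obtains m r where "0 < r" "r < m" "\<bar>m - hbar\<bar> \<le> r"
    "\<exists>y\<in>{0..1}. w y = m - r" "\<exists>y\<in>{0..1}. w y = m + r"
    "\<And>x. x \<in> {0..1} \<Longrightarrow> \<bar>w x - m\<bar> \<le> r"
    "\<And>x. x \<in> {0..1} \<Longrightarrow> \<epsilon>^2 * (dx w x)^2 = (m + r - w x) * (w x - (m - r)) * dd (m - r) (m + r) (w x)"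
    "\<And>x. x \<in> {0..1} \<Longrightarrow> \<epsilon>^2 * dx (dx w) x = - (nonlin (w x) - slope (m - r) (m + r))"
proof -
  define c where "c = integral {0..1} (\<lambda>y. nonlin (w y))"
  have w: "w \<in> C2" and pos: "\<And>x. x \<in> {0..1} \<Longrightarrow> w x > 0"
    and ode: "\<And>x. x \<in> {0<..<1} \<Longrightarrow> \<epsilon>^2 * dx (dx w) x + nonlin (w x) - c = 0"
    and per: "w 0 = w 1" "dx w 0 = dx w 1" and mean: "integral {0..1} w = hbar"
    using nt by (auto simp: nontrivial_solution_def solution_def c_def)
  note w' = C2D[OF w]
  have cn: "continuous_on {0..1} (\<lambda>x. nonlin (w x))"
  proof -
    have "w x \<noteq> 0" if "x \<in> {0..1}" for x using pos[OF that] by simp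
    then show ?thesis unfolding nonlin_eq by (intro continuous_intros w') auto
  qed
  \<comment> \<open>The equation is posed on the open interval; continuity of both sides carries it
    to the end points.\<close>
  have ode': "\<epsilon>^2 * dx (dx w) x = - (nonlin (w x) - c)" if "x \<in> {0..1}" for x
  proof -
    have cl: "closure {0<..<1::real} = {0..1}" by (simp add: closure_greaterThanLessThan)
    have "continuous_on (closure {0<..<1}) (\<lambda>x. \<epsilon>^2 * dx (dx w) x + nonlin (w x) - c)"
      unfolding cl by (intro continuous_intros w' cn)
    then have "\<epsilon>^2 * dx (dx w) x + nonlin (w x) - c = 0"
      by (rule continuous_constant_on_closure) (use ode that cl in auto)
    then show ?thesis by simp
  qed
  obtain x1 where x1: "x1 \<in> {0..1}" "\<And>y. y \<in> {0..1} \<Longrightarrow> w x1 \<le> w y"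
    using continuous_attains_inf[of "{0..1::real}" w] w'(3) by auto
  obtain x2 where x2: "x2 \<in> {0..1}" "\<And>y. y \<in> {0..1} \<Longrightarrow> w y \<le> w x2"
    using continuous_attains_sup[of "{0..1::real}" w] w'(3) by auto
  define a b where "a = w x1" "b = w x2"
  have ab: "a < b"
  proof (rule ccontr)
    assume "\<not> a < b"
    then have "w y = a" if "y \<in> {0..1}" for y using x1(2)[OF that] x2(2)[OF that] by (simp add: a_b_def)
    then have "w constant_on {0..1}" unfolding constant_on_def by blast
    then show False using nt by (simp add: nontrivial_solution_def)
  qed
  have a0: "a > 0" using pos[OF x1(1)] by (simp add: a_b_def)
  have d2: "dx w x2 = 0"
    by (rule periodic_max_derivative_zero[OF w'(1) per x2])
  have d1: "- dx w x1 = 0"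
    by (rule periodic_max_derivative_zero[of "\<lambda>x. - w x" "\<lambda>x. - dx w x"])
       (use per x1 in \<open>auto intro!: derivative_eq_intros w'(1)\<close>)
  \<comment> \<open>Twice the conserved quantity of the overview, with derivative
    \<open>2 * dx w\<close> times the left side of the equation.\<close>
  define E where "E x = \<epsilon>^2 * (dx w x)^2 + 2 * (prim (w x) - c * w x)" for x
  have "(E has_real_derivative 0) (at x within {0..1})" if x: "x \<in> {0..1}" for x
  proof -
    have p: "((\<lambda>x. prim (w x)) has_real_derivative nonlin (w x) * dx w x) (at x within {0..1})"
      by (rule DERIV_chain2[OF prim_deriv[OF pos[OF x]] w'(1)[OF x]])
    have "(E has_real_derivative 2 * dx w x * (\<epsilon>^2 * dx (dx w) x + (nonlin (w x) - c))) (at x within {0..1})"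
      unfolding E_def[abs_def] using p w'(1,2)[OF x]
      by (auto intro!: derivative_eq_intros simp: algebra_simps)
    then show ?thesis using ode'[OF x] by simp
  qed
  then obtain K where K: "\<And>x. x \<in> {0..1} \<Longrightarrow> E x = K"
    using has_field_derivative_zero_constant[of "{0..1}" E] by auto
  have Ka: "K = 2 * (prim a - c * a)" using K[OF x1(1)] d1 by (simp add: E_def a_b_def)
  have Kb: "K = 2 * (prim b - c * b)" using K[OF x2(1)] d2 by (simp add: E_def a_b_def)
  have c: "c = slope a b"
    using Ka Kb ab by (simp add: slope_def field_simps)
  define m r where "m = (a + b) / 2" "r = (b - a) / 2"
  have mr: "m - r = a" "m + r = b" by (auto simp: m_r_def field_simps)
  have I: "(w has_integral hbar) {0..1}"
    using integrable_integral[OF integrable_continuous_real[OF w'(3)]] mean by simp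
  have "a \<le> hbar" "hbar \<le> b"
    using has_integral_le[OF has_integral_const_real[of a 0 1] I] has_integral_le[OF I has_integral_const_real[of b 0 1]]
      x1(2) x2(2) by (auto simp: a_b_def)
  show ?thesis
  proof (rule that[of r m])
    show "0 < r" "r < m" using ab a0 by (auto simp: m_r_def field_simps)
    show "\<bar>m - hbar\<bar> \<le> r" using \<open>a \<le> hbar\<close> \<open>hbar \<le> b\<close> mr by linarith
    show "\<exists>y\<in>{0..1}. w y = m - r" "\<exists>y\<in>{0..1}. w y = m + r" unfolding mr a_b_def using x1 x2 by auto
    fix x :: real assume x: "x \<in> {0..1}"
    show "\<bar>w x - m\<bar> \<le> r" using x1(2)[OF x] x2(2)[OF x] mr unfolding a_b_def by linarith
    show "\<epsilon>^2 * dx (dx w) x = - (nonlin (w x) - slope (m - r) (m + r))" unfolding mr c[symmetric] by (rule ode'[OF x])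
    show "\<epsilon>^2 * (dx w x)^2 = (m + r - w x) * (w x - (m - r)) * dd (m - r) (m + r) (w x)"
      unfolding mr energy_identity[OF a0 ab pos[OF x], symmetric] c[symmetric]
      using K[OF x] Ka by (simp add: E_def algebra_simps)
  qed
qed

text \<open>The change of variable \<open>\<phi> = \<psi> x\<close>, where
  \<open>dx / \<epsilon> = d\<phi> / speed\<close>. It turns the period and mean conditions on [0,1]
  into integrals over the phase.\<close>

lemma phase_substitution:
  fixes \<psi> f :: "real \<Rightarrow> real"
  assumes "0 \<le> r" "r < m" and pos: "\<And>\<phi>. speed m r \<phi> > 0"
    and d: "\<And>x. x \<in> {0..1} \<Longrightarrow> (\<psi> has_real_derivative speed m r (\<psi> x) / \<epsilon>) (at x within {0..1})"
    and le: "\<psi> 0 \<le> \<psi> 1" and f: "continuous_on UNIV f"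
  shows "((\<lambda>x. f (\<psi> x) / \<epsilon>) has_integral integral {\<psi> 0..\<psi> 1} (\<lambda>\<phi>. f \<phi> / speed m r \<phi>)) {0..1}"
proof -
  have c\<psi>: "continuous_on {0..1} \<psi>"
    using d by (intro DERIV_continuous_on) auto
  then have "bounded (\<psi> ` {0..1})"
    by (intro compact_imp_bounded compact_continuous_image compact_Icc)
  then obtain B where "\<forall>y\<in>\<psi> ` {0..1}. norm y \<le> B" unfolding bounded_iff by blast
  then have B: "\<And>x. x \<in> {0..1} \<Longrightarrow> \<bar>\<psi> x\<bar> \<le> B" by simp
  have cf: "continuous_on {-B..B} (\<lambda>\<phi>. f \<phi> / speed m r \<phi>)"
    using assms(1,2) continuous_on_subset[OF f]
    by (intro continuous_intros continuous_on_speed) (auto simp: less_imp_neq[OF pos, symmetric])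
  have "((\<lambda>x. (speed m r (\<psi> x) / \<epsilon>) *\<^sub>R (f (\<psi> x) / speed m r (\<psi> x))) has_integral
      (integral {\<psi> 0..\<psi> 1} (\<lambda>\<phi>. f \<phi> / speed m r \<phi>) - integral {\<psi> 1..\<psi> 0} (\<lambda>\<phi>. f \<phi> / speed m r \<phi>))) {0..1}"
    by (rule has_integral_substitution_general[where s = "{}" and c = "-B" and d = B])
       (use B c\<psi> cf d in \<open>auto simp: abs_le_iff minus_le_iff\<close>)
  \<comment> \<open>The oriented integral is a difference of two set integrals; the reversed
    interval is empty or a single point.\<close>
  moreover have "integral {\<psi> 1..\<psi> 0} (\<lambda>\<phi>. f \<phi> / speed m r \<phi>) = 0"
    using le by (cases "\<psi> 0 = \<psi> 1") auto
  moreover have "(speed m r (\<psi> x) / \<epsilon>) *\<^sub>R (f (\<psi> x) / speed m r (\<psi> x)) = f (\<psi> x) / \<epsilon>" for x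
    using pos[of "\<psi> x"] by simp
  ultimately show ?thesis by simp
qed

text \<open>The normalised pair of position and velocity moves on the unit circle with positive
  angular velocity \<open>s / \<epsilon>\<close>, so integrating that velocity gives the phase. This
  avoids inverting the cosine at the turning points. Periodicity then forces a whole, positive
  number of turns.\<close>

lemma solution_phase:
  assumes sol: "nontrivial_solution hbar \<epsilon> w" and \<epsilon>: "\<epsilon> > 0"
    and r: "0 < r" "r < m"
    and bd: "\<And>x. x \<in> {0..1} \<Longrightarrow> \<bar>w x - m\<bar> \<le> r"
    and en: "\<And>x. x \<in> {0..1} \<Longrightarrow> \<epsilon>^2 * (dx w x)^2 = (m + r - w x) * (w x - (m - r)) * dd (m - r) (m + r) (w x)"
    and fo: "\<And>x. x \<in> {0..1} \<Longrightarrow> \<epsilon>^2 * dx (dx w) x = - (nonlin (w x) - slope (m - r) (m + r))"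
    and ddp: "\<And>z. \<bar>z - m\<bar> \<le> r \<Longrightarrow> dd (m - r) (m + r) z > 0"
  obtains \<alpha> and n :: nat where "n > 0"
    "integral {\<alpha>..\<alpha> + 2 * pi * real n} (\<lambda>\<phi>. 1 / speed m r \<phi>) = 1 / \<epsilon>"
    "integral {\<alpha>..\<alpha> + 2 * pi * real n} (\<lambda>\<phi>. (m - hbar + r * cos \<phi>) / speed m r \<phi>) = 0"
proof -
  have w: "w \<in> C2" and per: "w 0 = w 1" "dx w 0 = dx w 1" and mean: "integral {0..1} w = hbar"
    using sol by (auto simp: nontrivial_solution_def solution_def)
  note w' = C2D[OF w]
  have wpos: "w x > 0" if "x \<in> {0..1}" for x using bd[OF that] r by (auto simp: abs_le_iff)
  define a b where "a = m - r" "b = m + r"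
  have ab: "a > 0" "a < b" using r by (auto simp: a_b_def)
  define s where "s x = sqrt (dd a b (w x))" for x
  have s: "s x > 0" "s x ^ 2 = dd a b (w x)" if "x \<in> {0..1}" for x
    using ddp[OF bd[OF that]] by (auto simp: s_def a_b_def)
  have sd: "(s has_real_derivative ddx a b (w x) * dx w x / (2 * s x)) (at x within {0..1})" if x: "x \<in> {0..1}" for x
  proof -
    have 1: "((\<lambda>x. dd a b (w x)) has_real_derivative ddx a b (w x) * dx w x) (at x within {0..1})"
      by (rule DERIV_chain2[OF dd_deriv[OF wpos[OF x]] w'(1)[OF x]])
    have 2: "(sqrt has_real_derivative inverse (sqrt (dd a b (w x))) / 2) (at (dd a b (w x)))"
      using DERIV_real_sqrt s[OF x] by (metis zero_less_power)
    from DERIV_chain2[OF 2 1] show ?thesis unfolding s_def[abs_def] by (simp add: field_simps)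
  qed
  have sc: "continuous_on {0..1} s"
    using sd by (intro DERIV_continuous_on) auto
  \<comment> \<open>\<open>C\<close> and \<open>S\<close> are the cosine and sine of the phase; both pairs solve the same linear system.\<close>
  define C S where "C x = (w x - m) / r" "S x = - \<epsilon> * dx w x / (r * s x)" for x
  have CS: "C x ^ 2 + S x ^ 2 = 1" if x: "x \<in> {0..1}" for x
  proof -
    have "S x ^ 2 = \<epsilon>^2 * (dx w x)^2 / (r^2 * s x ^ 2)" by (simp add: C_S_def power_divide power_mult_distrib)
    also have "\<dots> = (b - w x) * (w x - a) / r^2" 
      using ddp[OF bd[OF x]] unfolding en[OF x] s(2)[OF x] by (simp add: a_b_def)
    finally show ?thesis using r unfolding C_S_def
      by (simp add: a_b_def field_simps power2_eq_square)
  qed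
  have Cd: "(C has_real_derivative - (S x * s x / \<epsilon>)) (at x within {0..1})" if x: "x \<in> {0..1}" for x
    unfolding C_S_def[abs_def] using w'(1)[OF x] s(1)[OF x] r \<epsilon>
    by (auto intro!: derivative_eq_intros simp: field_simps)
  have Sd: "(S has_real_derivative C x * s x / \<epsilon>) (at x within {0..1})" if x: "x \<in> {0..1}" for x
  proof -
    let ?S' = "((- \<epsilon> * dx (dx w) x) * (r * s x) - (- \<epsilon> * dx w x) * (r * (ddx a b (w x) * dx w x / (2 * s x)))) / ((r * s x) * (r * s x))"
    have S': "(S has_real_derivative ?S') (at x within {0..1})"
      unfolding C_S_def[abs_def] using s(1)[OF x] r
      by (intro DERIV_divide DERIV_cmult sd[OF x] w'(2)[OF x]) auto
    have fi: "2 * (\<epsilon>^2 * dx (dx w) x) = (a + b - 2 * w x) * dd a b (w x) + (b - w x) * (w x - a) * ddx a b (w x)"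
    proof -
      have "2 * (\<epsilon>^2 * dx (dx w) x) = - 2 * (nonlin (w x) - slope a b)" using fo[OF x] by (simp add: a_b_def)
      also note force_identity[OF ab wpos[OF x]]
      finally show ?thesis .
    qed
    have "2 * \<epsilon> * (r * s x)^2 * s x * ?S' = - (2 * (\<epsilon>^2 * dx (dx w) x)) * r * s x ^ 2 + (\<epsilon>^2 * (dx w x)^2) * r * ddx a b (w x)"
      using s(1)[OF x] r by (simp add: field_simps power2_eq_square)
    \<comment> \<open>The two terms with \<open>ddx\<close>, one from the force and one from
      differentiating \<open>s\<close>, cancel by the energy identity.\<close>
    also have "\<dots> = - (a + b - 2 * w x) * dd a b (w x) * r * dd a b (w x)"
      unfolding fi en[OF x] s(2)[OF x] a_b_def by (simp add: algebra_simps)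
    also have "\<dots> = 2 * \<epsilon> * (r * s x)^2 * s x * (C x * s x / \<epsilon>)"
      unfolding s(2)[OF x, symmetric] using r \<epsilon>
      by (simp add: C_S_def a_b_def field_simps power2_eq_square)
    finally have "?S' = C x * s x / \<epsilon>"
      by (rule mult_left_cancel[THEN iffD1, rotated]) (use s(1)[OF x] r \<epsilon> in auto)
    with S' show ?thesis by metis
  qed
  have "C 0 ^ 2 + S 0 ^ 2 = 1" by (rule CS) simp
  then obtain \<alpha> where \<alpha>: "C 0 = cos \<alpha>" "S 0 = sin \<alpha>" using sincos_total_2pi by metis
  define \<phi> where "\<phi> x = \<alpha> + integral {0..x} s / \<epsilon>" for x
  have \<phi>d: "(\<phi> has_real_derivative s x / \<epsilon>) (at x within {0..1})" if x: "x \<in> {0..1}" for x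
    unfolding \<phi>_def[abs_def] using integral_has_real_derivative[OF sc x] \<epsilon> by (auto intro!: derivative_eq_intros)
  \<comment> \<open>The inner product of two unit vectors rotating at the same rate is constant; its
    value 1 makes them coincide.\<close>
  define D where "D x = C x * cos (\<phi> x) + S x * sin (\<phi> x)" for x
  have "(D has_real_derivative 0) (at x within {0..1})" if x: "x \<in> {0..1}" for x
    unfolding D_def[abs_def] using Cd[OF x] Sd[OF x] \<phi>d[OF x]
    by (auto intro!: derivative_eq_intros simp: field_simps)
  then obtain K where K: "\<And>x. x \<in> {0..1} \<Longrightarrow> D x = K"
    using has_field_derivative_zero_constant[of "{0..1}" D] by auto
  have "D 0 = 1" using \<alpha> by (simp add: D_def \<phi>_def flip: power2_eq_square)
  then have D1: "D x = 1" if "x \<in> {0..1}" for x using K[OF that] K[of 0] by simp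
  have cs: "cos (\<phi> x) = C x \<and> sin (\<phi> x) = S x" if x: "x \<in> {0..1}" for x
  proof -
    have "(cos (\<phi> x) - C x)^2 + (sin (\<phi> x) - S x)^2
        = (cos (\<phi> x)^2 + sin (\<phi> x)^2) + (C x ^ 2 + S x ^ 2) - 2 * D x"
      unfolding D_def by (simp add: power2_eq_square algebra_simps)
    also have "\<dots> = 0" unfolding CS[OF x] D1[OF x] by simp
    finally show ?thesis by (simp add: sum_power2_eq_zero_iff)
  qed
  have s01: "s 0 = s 1" by (simp add: s_def per)
  have "cos (\<phi> 1) = cos \<alpha>" "sin (\<phi> 1) = sin \<alpha>"
    using cs[of 1] \<alpha> by (auto simp: C_S_def per s01)
  then obtain i :: int where i: "\<phi> 1 = \<alpha> + 2 * pi * of_int i"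
    by (metis sin_cos_eq_iff)
  have "integral {0..1} s > 0"
  proof -
    obtain x0 where x0: "x0 \<in> {0..1}" "\<And>y. y \<in> {0..1} \<Longrightarrow> s x0 \<le> s y"
      using continuous_attains_inf[of "{0..1::real}" s] sc by auto
    have "s x0 \<le> integral {0..1} s"
      using has_integral_le[OF has_integral_const_real[of "s x0" 0 1] integrable_integral[OF integrable_continuous_real[OF sc]]] x0(2) by simp
    with s(1)[OF x0(1)] show ?thesis by simp
  qed
  then have "\<phi> 1 > \<alpha>" using \<epsilon> by (simp add: \<phi>_def)
  then have "i > 0" using i by (simp add: zero_less_mult_iff)
  then obtain n :: nat where n: "n > 0" "\<phi> 1 = \<alpha> + 2 * pi * real n"
    using i by (metis of_int_of_nat_eq zero_less_imp_eq_int of_nat_0_less_iff)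
  have wm: "m + r * cos (\<phi> x) = w x" if "x \<in> {0..1}" for x
    using cs[OF that] r by (simp add: C_S_def)
  have sp: "speed m r y > 0" for y
    unfolding speed_def using ddp[of "m + r * cos y"] cos_bound[of r y] r by simp
  have \<phi>d': "(\<phi> has_real_derivative speed m r (\<phi> x) / \<epsilon>) (at x within {0..1})" if x: "x \<in> {0..1}" for x
    using \<phi>d[OF x] by (simp add: speed_def wm[OF x] s_def a_b_def)
  have \<phi>0: "\<phi> 0 = \<alpha>" by (simp add: \<phi>_def)
  have le: "\<phi> 0 \<le> \<phi> 1" using \<phi>0 \<open>\<phi> 1 > \<alpha>\<close> by simp
  have 1: "((\<lambda>x::real. 1 / \<epsilon>) has_integral integral {\<phi> 0..\<phi> 1} (\<lambda>\<phi>. 1 / speed m r \<phi>)) {0..1}"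
    by (rule phase_substitution[where f = "\<lambda>_. 1", OF _ r(2) sp \<phi>d' le]) (use r in auto)
  have 2: "((\<lambda>x. (m - hbar + r * cos (\<phi> x)) / \<epsilon>) has_integral integral {\<phi> 0..\<phi> 1} (\<lambda>\<phi>. (m - hbar + r * cos \<phi>) / speed m r \<phi>)) {0..1}"
    by (rule phase_substitution[where f = "\<lambda>\<phi>. m - hbar + r * cos \<phi>", OF _ r(2) sp \<phi>d' le])
       (use r in \<open>auto intro!: continuous_intros\<close>)
  \<comment> \<open>The integral of \<open>(w - hbar) / \<epsilon>\<close> is computed twice: here
    by the mean condition, giving 0, and next by substitution.\<close>
  have 3: "((\<lambda>x. (w x - hbar) / \<epsilon>) has_integral ((hbar - hbar) / \<epsilon>)) {0..1}"
    using integrable_integral[OF integrable_continuous_real[OF w'(3)]] has_integral_const_real[of hbar 0 1] mean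
    by (intro has_integral_divide has_integral_diff) auto
  have 4: "((\<lambda>x. (w x - hbar) / \<epsilon>) has_integral integral {\<phi> 0..\<phi> 1} (\<lambda>\<phi>. (m - hbar + r * cos \<phi>) / speed m r \<phi>)) {0..1}"
  proof (rule has_integral_eq[OF _ 2])
    fix x :: real assume "x \<in> {0..1}"
    from wm[OF this] show "(m - hbar + r * cos (\<phi> x)) / \<epsilon> = (w x - hbar) / \<epsilon>" by (metis add.commute add_diff_eq)
  qed
  have J: "integral {\<phi> 0..\<phi> 1} (\<lambda>\<phi>. (m - hbar + r * cos \<phi>) / speed m r \<phi>) = 0"
    using has_integral_unique[OF 4 3] by simp
  have T: "integral {\<phi> 0..\<phi> 1} (\<lambda>\<phi>. 1 / speed m r \<phi>) = 1 / \<epsilon>"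
    using has_integral_unique[OF 1 has_integral_const_real[of "1 / \<epsilon>" 0 1]] by simp
  show ?thesis by (rule that[OF n(1) T[unfolded \<phi>0 n(2)] J[unfolded \<phi>0 n(2)]])
qed

section \<open>From phases to solutions\<close>

text \<open>The separable equation \<open>\<psi>' = 1 / g \<psi>\<close> is solved by inverting the
  strictly increasing travel time, the integral of \<open>g\<close> from 0.\<close>

lemma exists_inverse_of_travel_time:
  fixes g :: "real \<Rightarrow> real"
  assumes g: "continuous_on UNIV g" "\<And>\<phi>. g \<phi> > 0" and L: "L > 0" "integral {0..L} g = T"
  obtains \<psi> where "\<psi> 0 = 0" "\<psi> T = L"
    "\<And>y. y \<in> {0..T} \<Longrightarrow> \<psi> y \<in> {0..L}"
    "\<And>y. y \<in> {0..T} \<Longrightarrow> (\<psi> has_real_derivative 1 / g (\<psi> y)) (at y)"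
    "\<And>\<phi>. \<phi> \<in> {0..L} \<Longrightarrow> \<exists>y\<in>{0..T}. \<psi> y = \<phi>"
proof -
  \<comment> \<open>Starting at \<open>-1\<close> keeps \<open>0\<close> and \<open>L\<close> interior, so that the inverse is differentiable on both sides.\<close>
  define \<Theta> where "\<Theta> \<phi> = integral {-1..\<phi>} g - integral {-1..0} g" for \<phi>
  define S where "S = {-1<..<L + 1}"
  have cg: "continuous_on A g" for A using g(1) continuous_on_subset by blast
  have d: "(\<Theta> has_real_derivative g \<phi>) (at \<phi>)" if "\<phi> \<in> S" for \<phi>
  proof -
    have "((\<lambda>\<phi>. integral {-1..\<phi>} g) has_real_derivative g \<phi>) (at \<phi> within {-1..L+1})"
      by (rule integral_has_real_derivative[OF cg]) (use that in \<open>auto simp: S_def\<close>)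
    moreover have "at \<phi> within {-1..L+1} = at \<phi>"
      by (rule at_within_Icc_at) (use that in \<open>auto simp: S_def\<close>)
    ultimately show ?thesis unfolding \<Theta>_def[abs_def] by (auto intro!: derivative_eq_intros)
  qed
  have less: "\<Theta> x < \<Theta> y" if "x < y" "x \<in> S" "y \<in> S" for x y
  proof (rule DERIV_pos_imp_increasing[OF that(1)])
    fix z assume "x \<le> z" "z \<le> y"
    then have "z \<in> S" using that by (auto simp: S_def)
    then show "\<exists>D. (\<Theta> has_real_derivative D) (at z) \<and> 0 < D" using d g(2) by blast
  qed
  then have inj: "inj_on \<Theta> S" by (intro linorder_inj_onI') (metis less_irrefl)
  define \<psi> where "\<psi> = the_inv_into S \<Theta>"
  have \<psi>: "\<psi> (\<Theta> \<phi>) = \<phi>" if "\<phi> \<in> S" for \<phi> unfolding \<psi>_def by (rule the_inv_into_f_f[OF inj that])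
  have sub: "{0..L} \<subseteq> S" using L by (auto simp: S_def)
  have \<Theta>0: "\<Theta> 0 = 0" by (simp add: \<Theta>_def)
  have \<Theta>L: "\<Theta> L = T"
  proof -
    have "integral {-1..0} g + integral {0..L} g = integral {-1..L} g"
      using L by (intro Henstock_Kurzweil_Integration.integral_combine integrable_continuous_real cg) auto
    then show ?thesis using L(2) by (simp add: \<Theta>_def)
  qed
  have c\<Theta>: "continuous_on {0..L} \<Theta>"
    by (rule DERIV_continuous_on[where D = g], rule has_field_derivative_at_within[OF d]) (use sub in auto)
  have ex: "\<exists>\<phi>\<in>{0..L}. \<Theta> \<phi> = y" if "y \<in> {0..T}" for y
    using IVT'[of \<Theta> 0 y L] that c\<Theta> L \<Theta>0 \<Theta>L by force
  show ?thesis
  proof (rule that[of \<psi>])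
    show "\<psi> 0 = 0" using \<psi>[of 0] \<Theta>0 L by (simp add: S_def)
    show "\<psi> T = L" using \<psi>[of L] \<Theta>L L by (simp add: S_def)
    show "\<psi> y \<in> {0..L}" if "y \<in> {0..T}" for y using ex[OF that] \<psi> sub by force
    show "(\<psi> has_real_derivative 1 / g (\<psi> y)) (at y)" if y: "y \<in> {0..T}" for y
    proof -
      obtain \<phi> where \<phi>: "\<phi> \<in> {0..L}" "\<Theta> \<phi> = y" using ex[OF y] by blast
      have \<phi>S: "\<phi> \<in> S" using \<phi> sub by blast
      have "(\<psi> has_derivative (*) (inverse (g \<phi>))) (at (\<Theta> \<phi>))"
      proof (rule has_derivative_inverse_strong[of S \<phi> \<Theta>])
        show "continuous_on S \<Theta>" by (rule DERIV_continuous_on[where D = g]) (rule has_field_derivative_at_within[OF d])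
        show "(\<Theta> has_derivative (*) (g \<phi>)) (at \<phi>)" using d[OF \<phi>S] by (simp add: has_field_derivative_def)
        show "(*) (g \<phi>) \<circ> (*) (inverse (g \<phi>)) = id" using g(2)[of \<phi>] by (auto simp: fun_eq_iff)
      qed (use \<phi>S \<psi> in \<open>auto simp: S_def\<close>)
      then have "(\<psi> has_real_derivative inverse (g \<phi>)) (at (\<Theta> \<phi>))" by (simp add: has_field_derivative_def)
      moreover have "\<psi> y = \<phi>" using \<psi>[of \<phi>] \<phi> sub by auto
      ultimately show ?thesis by (simp add: \<phi> inverse_eq_divide)
    qed
    show "\<exists>y\<in>{0..T}. \<psi> y = \<phi>" if "\<phi> \<in> {0..L}" for \<phi>
    proof (rule bexI[of _ "\<Theta> \<phi>"])
      show "\<psi> (\<Theta> \<phi>) = \<phi>" using \<psi> that sub by auto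
      have "\<Theta> 0 \<le> \<Theta> \<phi>" "\<Theta> \<phi> \<le> \<Theta> L"
        using less[of 0 \<phi>] less[of \<phi> L] that L unfolding S_def by (auto simp: less_eq_real_def)
      then show "\<Theta> \<phi> \<in> {0..T}" using \<Theta>0 \<Theta>L by simp
    qed
  qed
qed

text \<open>The phase \<open>\<psi>\<close> is obtained from its travel time, and
  \<open>w = m + r * cos \<psi>\<close>. The period integral makes the orbit close exactly at
  \<open>x = 1\<close>, and the second integral fixes the mean. The velocity and force bounds needed
  for the C2 norm are returned as well.\<close>

lemma solution_of_phase:
  fixes n :: nat
  assumes \<epsilon>: "\<epsilon> > 0" and r: "0 < r" "r < m" and n: "n > 0"
    and ddp: "\<And>z. \<bar>z - m\<bar> \<le> r \<Longrightarrow> dd (m - r) (m + r) z > 0"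
    and T: "integral {0..2 * pi * real n} (\<lambda>\<phi>. 1 / speed m r \<phi>) = 1 / \<epsilon>"
    and J: "integral {0..2 * pi * real n} (\<lambda>\<phi>. (m - hbar + r * cos \<phi>) / speed m r \<phi>) = 0"
  obtains w where "nontrivial_solution hbar \<epsilon> w"
    "\<And>x. x \<in> {0..1} \<Longrightarrow> \<bar>w x - m\<bar> \<le> r"
    "\<And>x. x \<in> {0..1} \<Longrightarrow> \<exists>\<phi>. \<epsilon> * dx w x = r * sin \<phi> * speed m r \<phi>"
    "\<And>x. x \<in> {0..1} \<Longrightarrow> \<epsilon>^2 * dx (dx w) x = - (nonlin (w x) - slope (m - r) (m + r))"
proof -
  define L where "L = 2 * pi * real n"
  have L: "L > 0" "2 * pi \<le> L" using n by (auto simp: L_def)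
  have sp: "speed m r y > 0" for y
    unfolding speed_def using ddp[of "m + r * cos y"] cos_bound[of r y] r by simp
  have c: "continuous_on UNIV (\<lambda>\<phi>. \<epsilon> / speed m r \<phi>)"
    using r by (intro continuous_intros continuous_on_speed) (auto simp: less_imp_neq[OF sp, symmetric])
  have "(\<lambda>\<phi>. \<epsilon> / speed m r \<phi>) = (\<lambda>\<phi>. \<epsilon> * (1 / speed m r \<phi>))" by simp
  then have I: "integral {0..L} (\<lambda>\<phi>. \<epsilon> / speed m r \<phi>) = 1"
    using T \<epsilon> by (simp only: integral_mult_right L_def) simp
  obtain \<psi> where \<psi>: "\<psi> 0 = 0" "\<psi> 1 = L"
    "\<And>y. y \<in> {0..1} \<Longrightarrow> \<psi> y \<in> {0..L}"
    "\<And>y. y \<in> {0..1} \<Longrightarrow> (\<psi> has_real_derivative 1 / (\<epsilon> / speed m r (\<psi> y))) (at y)"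
    "\<And>\<phi>. \<phi> \<in> {0..L} \<Longrightarrow> \<exists>y\<in>{0..1}. \<psi> y = \<phi>"
    using exists_inverse_of_travel_time[OF c _ L(1) I] sp \<epsilon> by auto
  have \<psi>d: "(\<psi> has_real_derivative speed m r (\<psi> x) / \<epsilon>) (at x within {0..1})" if "x \<in> {0..1}" for x
    using has_field_derivative_at_within[OF \<psi>(4)[OF that]] by simp
  define a b where "a = m - r" "b = m + r"
  have ab: "a > 0" "a < b" using r by (auto simp: a_b_def)
  define w where "w x = m + r * cos (\<psi> x)" for x
  have bd: "\<bar>w x - m\<bar> \<le> r" for x using cos_bound[of r] r by (simp add: w_def)
  have wpos: "w x > 0" for x using bd[of x] r by (auto simp: abs_le_iff)
  define s where "s x = sqrt (dd a b (w x))" for x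
  have s: "s x > 0" "s x ^ 2 = dd a b (w x)" for x
    using ddp[OF bd[of x]] by (auto simp: s_def a_b_def)
  have ss: "speed m r (\<psi> x) = s x" for x by (simp add: s_def speed_def w_def a_b_def)
  note \<psi>d = \<psi>d[unfolded ss]
  define w1 where "w1 x = - (r * sin (\<psi> x) * s x) / \<epsilon>" for x
  define w2 where "w2 x = - (nonlin (w x) - slope a b) / \<epsilon>^2" for x
  have wd: "(w has_real_derivative w1 x) (at x within {0..1})" if x: "x \<in> {0..1}" for x
    unfolding w_def[abs_def] w1_def using \<psi>d[OF x]
    by (auto intro!: derivative_eq_intros)
  have sd: "(s has_real_derivative ddx a b (w x) * w1 x / (2 * s x)) (at x within {0..1})" if x: "x \<in> {0..1}" for x
  proof -
    have 1: "((\<lambda>x. dd a b (w x)) has_real_derivative ddx a b (w x) * w1 x) (at x within {0..1})"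
      by (rule DERIV_chain2[OF dd_deriv[OF wpos] wd[OF x]])
    have 2: "(sqrt has_real_derivative inverse (sqrt (dd a b (w x))) / 2) (at (dd a b (w x)))"
      using DERIV_real_sqrt s[of x] by (metis zero_less_power)
    from DERIV_chain2[OF 2 1] show ?thesis unfolding s_def[abs_def] by (simp add: field_simps)
  qed
  have wd2: "(w1 has_real_derivative w2 x) (at x within {0..1})" if x: "x \<in> {0..1}" for x
  proof -
    let ?D = "- (r * (cos (\<psi> x) * (s x / \<epsilon>)) * s x + r * sin (\<psi> x) * (ddx a b (w x) * w1 x / (2 * s x))) / \<epsilon>"
    have 1: "(w1 has_real_derivative ?D) (at x within {0..1})"
      unfolding w1_def[abs_def]
      using \<psi>d[OF x] sd[OF x, unfolded w1_def] \<epsilon> s(1)[of x]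
      by (auto intro!: derivative_eq_intros simp: w1_def field_simps)
    have "2 * (nonlin (w x) - slope a b) = 2 * r * cos (\<psi> x) * dd a b (w x) - (b - w x) * (w x - a) * ddx a b (w x)"
      using force_identity[OF ab wpos, of x] by (simp add: a_b_def w_def algebra_simps)
    also have "(b - w x) * (w x - a) = r^2 * sin (\<psi> x) ^ 2"
      unfolding sin_squared_eq by (simp add: a_b_def w_def algebra_simps power2_eq_square)
    finally have f: "nonlin (w x) - slope a b = r * cos (\<psi> x) * s x ^ 2 - r^2 * sin (\<psi> x) ^ 2 * ddx a b (w x) / 2"
      by (simp add: s(2) field_simps)
    have "?D = w2 x"
      unfolding w2_def f w1_def using s(1)[of x] \<epsilon> by (simp add: field_simps power2_eq_square)
    with 1 show ?thesis by simp
  qed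
  have cw: "continuous_on {0..1} w" using wd by (intro DERIV_continuous_on) auto
  have cn: "continuous_on {0..1} (\<lambda>x. nonlin (w x))"
    unfolding nonlin_eq using less_imp_neq[OF wpos, symmetric] by (intro continuous_intros cw) auto
  have cw2: "continuous_on {0..1} w2" unfolding w2_def[abs_def] using \<epsilon> by (intro continuous_intros cn) auto
  have C2: "w \<in> C2" "\<And>x. x \<in> {0..1} \<Longrightarrow> dx w x = w1 x" "\<And>x. x \<in> {0..1} \<Longrightarrow> dx (dx w) x = w2 x"
    using C2I[OF wd wd2 cw2] by auto
  have trig: "cos L = 1" "sin L = 0" using period_cos[of 0 n] period_sin[of 0 n] by (auto simp: L_def)
  have w01: "w 0 = w 1" by (simp add: w_def \<psi> trig)
  have w101: "w1 0 = w1 1" by (simp add: w1_def \<psi> trig)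
  have mean: "integral {0..1} w = hbar"
  proof -
    have "((\<lambda>x. (m - hbar + r * cos (\<psi> x)) / \<epsilon>) has_integral integral {\<psi> 0..\<psi> 1} (\<lambda>\<phi>. (m - hbar + r * cos \<phi>) / speed m r \<phi>)) {0..1}"
      by (rule phase_substitution[OF _ r(2) sp])
         (use r \<psi>d L \<psi>(1,2) in \<open>auto intro!: continuous_intros simp: ss\<close>)
    then have "((\<lambda>x. (m - hbar + r * cos (\<psi> x)) / \<epsilon>) has_integral 0) {0..1}"
      using J by (simp add: \<psi> L_def)
    from has_integral_add[OF has_integral_mult_right[OF this, of \<epsilon>] has_integral_const_real[of hbar 0 1]]
    have "(w has_integral hbar) {0..1}" using \<epsilon> by (simp add: w_def[abs_def])
    then show ?thesis by (rule integral_unique)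
  qed
  \<comment> \<open>Integrating the second-order equation over a period removes the second
    derivative, so the nonlocal term must equal the chord slope.\<close>
  have force: "integral {0..1} (\<lambda>x. nonlin (w x)) = slope a b"
  proof -
    have "(w2 has_integral (w1 1 - w1 0)) {0..1}"
      by (rule fundamental_theorem_of_calculus)
         (use wd2 in \<open>auto simp: has_real_derivative_iff_has_vector_derivative\<close>)
    then have "(w2 has_integral 0) {0..1}" by (simp add: w101)
    from has_integral_diff[OF has_integral_const_real[of "slope a b" 0 1] has_integral_mult_right[OF this, of "\<epsilon>^2"]]
    have "((\<lambda>x. nonlin (w x)) has_integral slope a b) {0..1}" using \<epsilon> by (simp add: w2_def)
    then show ?thesis by (rule integral_unique)
  qed
  have nc: "\<not> w constant_on {0..1}"
  proof
    assume "w constant_on {0..1}"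
    then obtain k where k: "\<And>x. x \<in> {0..1} \<Longrightarrow> w x = k" by (auto simp: constant_on_def)
    \<comment> \<open>At least one full turn is made, so the phase passes both 0 and
      \<open>pi\<close>, where \<open>w\<close> equals \<open>m + r\<close> and
      \<open>m - r\<close>.\<close>
    obtain y where y: "y \<in> {0..1}" "\<psi> y = pi" using \<psi>(5)[of pi] L by auto
    have "w y = w 0" using k[of 0] k[OF y(1)] by simp
    then show False using y r by (simp add: w_def \<psi>)
  qed
  show ?thesis
  proof (rule that[of w])
    show "nontrivial_solution hbar \<epsilon> w"
      unfolding nontrivial_solution_def solution_def
      using C2 wpos w01 w101 mean force nc \<epsilon> by (auto simp: w2_def)
    show "\<bar>w x - m\<bar> \<le> r" for x by (rule bd)
    show "\<exists>\<phi>. \<epsilon> * dx w x = r * sin \<phi> * speed m r \<phi>" if "x \<in> {0..1}" for x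
      \<comment> \<open>The phase \<open>- \<psi> x\<close> absorbs the minus sign of
        \<open>w1\<close>; \<open>speed\<close> is even in the phase.\<close>
      using C2(2)[OF that] \<epsilon> by (intro exI[of _ "- \<psi> x"]) (simp add: w1_def speed_def s_def a_b_def w_def)
    show "\<epsilon>^2 * dx (dx w) x = - (nonlin (w x) - slope (m - r) (m + r))" if "x \<in> {0..1}" for x
      using C2(3)[OF that] \<epsilon> by (simp add: w2_def a_b_def)
  qed
qed

section \<open>The bifurcations\<close>

lemma eventually_mult_less:
  fixes c d :: real
  assumes "d > 0"
  shows "eventually (\<lambda>r. c * r < d) (at_right 0)"
proof -
  have "((\<lambda>r. c * r) \<longlongrightarrow> c * 0) (at_right 0)" by (intro tendsto_intros)
  then show ?thesis using order_tendstoD(2) assms by fastforce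
qed

text \<open>By the mean value theorem the chord slope is a value of \<open>nonlin\<close> inside the
  interval; the constant bounds \<open>\<bar>nonlin1\<bar>\<close> beyond \<open>h / 2\<close>. This
  controls the second derivative of a solution by its amplitude.\<close>

lemma slope_bound:
  assumes h: "h > 0" and ab: "h / 2 \<le> a" "a < b" and x: "x \<in> {a..b}"
  shows "\<bar>nonlin x - slope a b\<bar> \<le> (3 / (h/2)^4 + 6 / (h/2)^7) * (b - a)"
proof -
  define M where "M = 3 / (h/2)^4 + 6 / (h/2)^7"
  have "\<exists>z>a. z < b \<and> prim b - prim a = (b - a) * nonlin z"
    by (rule MVT2[OF ab(2)]) (use ab h in \<open>auto intro!: prim_deriv\<close>)
  then obtain z where z: "a < z" "z < b" "prim b - prim a = (b - a) * nonlin z" by blast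
  have sl: "slope a b = nonlin z" using z ab by (simp add: slope_def)
  have M: "norm (nonlin1 t) \<le> M" if "t \<in> {a..b}" for t
  proof -
    have th: "t \<ge> h / 2" using that ab by auto
    have "\<bar>nonlin1 t\<bar> \<le> 3 / t^4 + 6 / t^7"
      unfolding nonlin1_def using th h by (intro order_trans[OF abs_triangle_ineq4]) auto
    also have "\<dots> \<le> M" unfolding M_def
      using th h by (intro add_mono divide_left_mono power_mono mult_pos_pos zero_less_power) auto
    finally show ?thesis by simp
  qed
  have M0: "M \<ge> 0" using M[of a] ab by (auto intro: order_trans[OF norm_ge_zero])
  have "norm (nonlin x - nonlin z) \<le> M * norm (x - z)"
  proof (rule field_differentiable_bound[of "{a..b}" nonlin nonlin1])
    show "(nonlin has_real_derivative nonlin1 t) (at t within {a..b})" if "t \<in> {a..b}" for t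
      by (rule has_field_derivative_at_within[OF nonlin_deriv]) (use that ab h in auto)
  qed (use M x z in auto)
  also have "\<dots> \<le> M * (b - a)" using M0 x z by (intro mult_left_mono) auto
  finally show ?thesis by (simp add: sl M_def)
qed

text \<open>Intermediate value theorem in \<open>m\<close>. Uniqueness is not claimed: the
  second-order period estimate covers every such centre.\<close>

lemma exists_centre:
  assumes r: "0 < r" "2 * r < h" and N: "N \<ge> 0"
    and ddp: "\<And>m z. \<bar>m - h\<bar> \<le> r \<Longrightarrow> \<bar>z - m\<bar> \<le> r \<Longrightarrow> dd (m - r) (m + r) z > 0"
  obtains m where "\<bar>m - h\<bar> \<le> r" "integral {0..N} (\<lambda>\<phi>. (m - h + r * cos \<phi>) / speed m r \<phi>) = 0"
proof -
  define J where "J m = integral (cbox 0 N) (\<lambda>\<phi>. (m - h + r * cos \<phi>) / speed m r \<phi>)" for m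
  have sp: "speed m r \<phi> > 0" if "\<bar>m - h\<bar> \<le> r" for m \<phi>
    unfolding speed_def using ddp[OF that, of "m + r * cos \<phi>"] cos_bound[of r \<phi>] r by simp
  have pos: "0 < m - r" "0 < m + r" "0 < m + r * cos \<phi>" if "m \<in> {h-r..h+r}" for m \<phi>
    using that r cos_bound'[of r m \<phi>] by auto
  have "continuous_on ({h-r..h+r} \<times> cbox 0 N) (\<lambda>(m, \<phi>). (m - h + r * cos \<phi>) / speed m r \<phi>)"
    unfolding case_prod_unfold speed_def
  proof (intro continuous_intros continuous_on_dd ballI)
    fix z assume z: "z \<in> {h-r..h+r} \<times> cbox 0 N"
    then have "\<bar>fst z - h\<bar> \<le> r" by (auto simp: abs_le_iff)
    from sp[OF this, of "snd z"] show "sqrt (dd (fst z - r) (fst z + r) (fst z + r * cos (snd z))) \<noteq> 0"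
      by (simp add: speed_def)
  qed (use pos in auto)
  then have c: "continuous_on {h-r..h+r} J"
    unfolding J_def by (rule integral_continuous_on_param)
  have int: "(\<lambda>\<phi>. (m - h + r * cos \<phi>) / speed m r \<phi>) integrable_on cbox 0 N" if "\<bar>m - h\<bar> \<le> r" for m
    unfolding cbox_interval using r that sp[OF that]
    by (intro integrable_continuous_real continuous_intros continuous_on_speed)
       (auto simp: abs_le_iff less_imp_neq[symmetric])
  \<comment> \<open>At \<open>m = h + r\<close> and \<open>m = h - r\<close> the integrand has a constant sign.\<close>
  have hi: "J (h + r) \<ge> 0"
    unfolding J_def
  proof (rule integral_nonneg)
    show "(\<lambda>\<phi>. (h + r - h + r * cos \<phi>) / speed (h + r) r \<phi>) integrable_on cbox 0 N" using int[of "h + r"] r by simp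
    show "0 \<le> (h + r - h + r * cos \<phi>) / speed (h + r) r \<phi>" for \<phi>
      using sp[of "h + r" \<phi>] r abs_le_D2[OF cos_bound[of r \<phi>]] by (intro divide_nonneg_pos) linarith+
  qed
  have lo: "J (h - r) \<le> 0"
  proof -
    have "0 \<le> integral (cbox 0 N) (\<lambda>\<phi>. - ((h - r - h + r * cos \<phi>) / speed (h - r) r \<phi>))"
    proof (rule integral_nonneg)
      show "(\<lambda>\<phi>. - ((h - r - h + r * cos \<phi>) / speed (h - r) r \<phi>)) integrable_on cbox 0 N"
        using int[of "h - r"] r by (intro integrable_neg) auto
      show "0 \<le> - ((h - r - h + r * cos \<phi>) / speed (h - r) r \<phi>)" for \<phi>
        using sp[of "h - r" \<phi>] r cos_bound[of r \<phi>]
        unfolding minus_divide_left by (intro divide_nonneg_pos) (auto simp: abs_le_iff)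
    qed
    then show ?thesis by (simp add: J_def)
  qed
  obtain m where "h - r \<le> m" "m \<le> h + r" "J m = 0"
    using IVT'[of J "h - r" 0 "h + r"] lo hi c r by auto
  then show ?thesis using that[of m] by (simp add: J_def abs_le_iff)
qed

text \<open>The amplitude is \<open>r\<close>, the number of turns is \<open>n\<close>, and \<open>sqrt (nonlin1 h) / (2 * pi * e0)\<close> equals \<open>k\<close>
  when \<open>e0 = eps h k\<close>.\<close>

definition on_branch :: "real \<Rightarrow> real \<Rightarrow> real \<Rightarrow> real \<Rightarrow> real \<Rightarrow> bool" where
  "on_branch h C e0 \<eta> \<epsilon> \<longleftrightarrow>
    (\<exists>r n. 0 < r \<and> r < \<eta> \<and> n > 0 \<and> \<bar>real n - sqrt (nonlin1 h) / (2 * pi * e0)\<bar> < \<eta> \<and>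
     \<bar>sqrt (nonlin1 h) / \<epsilon> - 2 * pi * real n * (1 + branch_coeff h * r^2)\<bar> \<le> C * r^3 * (2 * pi * real n))"

lemma eps_eq:
  assumes h: "h > 0"
  shows "eps h k = sqrt (nonlin1 h) / (2 * pi * real k)"
  using DERIV_imp_deriv[OF nonlin_deriv[OF h]] by (simp add: eps_def mult_ac)

text \<open>For each small amplitude \<open>r\<close>, choose a centre with zero mean deviation over
  \<open>k\<close> turns and take \<open>\<epsilon>\<close> as the reciprocal of the travel time.
  Both the distance of \<open>\<epsilon>\<close> from \<open>eps h k\<close> and the C2 distance
  from the constant are \<open>O(r)\<close>.\<close>

lemma bifurcation_at_eps:
  fixes h :: real and k :: nat
  assumes h: "h > 0" and d1: "nonlin1 h > 0" and k: "k > 0"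
  shows "bifurcation_at h (eps h k)"
  unfolding bifurcation_at_def
proof (intro allI impI)
  fix \<delta> :: real assume \<delta>: "\<delta> > 0"
  define N where "N = 2 * pi * real k"
  define e0 where "e0 = eps h k"
  have N: "N > 0" using k by (simp add: N_def)
  have e0: "e0 > 0" "sqrt (nonlin1 h) = e0 * N" using d1 N k by (auto simp: e0_def eps_eq[OF h] N_def)
  obtain \<rho> C where \<rho>: "0 < \<rho>" "\<rho> < h / 4" "C > 0"
    and dd: "\<And>r m x. 0 < r \<Longrightarrow> r < \<rho> \<Longrightarrow> \<bar>m - h\<bar> \<le> r \<Longrightarrow> \<bar>x - m\<bar> \<le> r \<Longrightarrow>
       dd (m - r) (m + r) x > 0 \<and> \<bar>dd (m - r) (m + r) x - nonlin1 h\<bar> \<le> C * r"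
    and est1: "\<And>r m \<alpha> n. 0 < r \<Longrightarrow> r < \<rho> \<Longrightarrow> \<bar>m - h\<bar> \<le> r \<Longrightarrow>
       \<bar>sqrt (nonlin1 h) * integral {\<alpha>..\<alpha> + 2 * pi * real n} (\<lambda>\<phi>. 1 / speed m r \<phi>) - 2 * pi * real n\<bar>
         \<le> C * r * (2 * pi * real n)"
    and est2: "\<And>r m \<alpha> n. 0 < r \<Longrightarrow> r < \<rho> \<Longrightarrow> \<bar>m - h\<bar> \<le> r \<Longrightarrow> n > 0 \<Longrightarrow>
       integral {\<alpha>..\<alpha> + 2 * pi * real n} (\<lambda>\<phi>. (m - h + r * cos \<phi>) / speed m r \<phi>) = 0 \<Longrightarrow>
       \<bar>sqrt (nonlin1 h) * integral {\<alpha>..\<alpha> + 2 * pi * real n} (\<lambda>\<phi>. 1 / speed m r \<phi>)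
         - 2 * pi * real n * (1 + branch_coeff h * r^2)\<bar> \<le> C * r^3 * (2 * pi * real n)"
    by (rule period_estimate[OF h d1]) (rule that)
  define M where "M = 3 / (h/2)^4 + 6 / (h/2)^7"
  have M: "M > 0" using h by (auto simp: M_def intro!: add_pos_pos)
  \<comment> \<open>The three summands bound the function, its first and its second derivative per
    unit of \<open>r\<close>, using \<open>\<epsilon> \<ge> e0 / 2\<close>.\<close>
  define K where "K = 2 + 2 * (nonlin1 h + 2) / e0 + 8 * M / e0^2"
  have "eventually (\<lambda>r. 0 < r \<and> 1 * r < \<rho> \<and> C * r < 1 / 2 \<and> K * r < \<delta> \<and> (2 * C * e0) * r < \<delta>) (at_right 0)"
    by (intro eventually_conj eventually_mult_less eventually_at_right_less) (use \<rho> \<delta> in auto)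
  then obtain r where r: "0 < r" "r < \<rho>" "C * r < 1 / 2" "K * r < \<delta>" "2 * C * e0 * r < \<delta>"
    using eventually_happens'[OF trivial_limit_at_right_real] by force
  obtain m where m: "\<bar>m - h\<bar> \<le> r" "integral {0..N} (\<lambda>\<phi>. (m - h + r * cos \<phi>) / speed m r \<phi>) = 0"
  proof (rule exists_centre[of r h N])
    show "dd (m - r) (m + r) z > 0" if "\<bar>m - h\<bar> \<le> r" "\<bar>z - m\<bar> \<le> r" for m z
      using dd[of r m z] that r by blast
  qed (use r \<rho> N in auto)
  define I where "I = integral {0..N} (\<lambda>\<phi>. 1 / speed m r \<phi>)"
  \<comment> \<open>This is the ratio \<open>e0 / \<epsilon>\<close>, which the first-order period
    estimate puts within \<open>C * r\<close> of 1.\<close>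
  define x where "x = e0 * I"
  have "\<bar>e0 * N * I - N\<bar> \<le> C * r * N"
    using est1[OF r(1,2) m(1), of 0 k] unfolding e0(2) by (simp add: I_def N_def)
  also have "e0 * N * I - N = (x - 1) * N" by (simp add: x_def algebra_simps)
  also have "\<bar>(x - 1) * N\<bar> = \<bar>x - 1\<bar> * N" using N by (simp add: abs_mult)
  finally have x: "\<bar>x - 1\<bar> \<le> C * r" using N by simp
  then have x2: "x > 1 / 2" "x < 3 / 2" using r by (auto simp: abs_le_iff)
  then have I: "I > 0" using e0 unfolding x_def by (metis less_trans half_gt_zero_iff zero_less_mult_pos zero_less_one)
  define \<epsilon> where "\<epsilon> = 1 / I"
  have \<epsilon>: "\<epsilon> > 0" "\<epsilon> = e0 / x" using I e0 by (auto simp: \<epsilon>_def x_def)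
  have \<epsilon>2: "\<epsilon> \<ge> e0 / 2" unfolding \<epsilon>(2) using x2 e0 by (simp add: field_simps)
  have close: "\<bar>\<epsilon> - e0\<bar> < \<delta>"
  proof -
    have "\<epsilon> - e0 = e0 * (1 - x) / x" using x2 by (simp add: \<epsilon>(2) field_simps)
    then have "\<bar>\<epsilon> - e0\<bar> = e0 * \<bar>x - 1\<bar> / x" using x2 e0 by (simp add: abs_mult abs_minus_commute)
    also have "\<dots> \<le> e0 * \<bar>x - 1\<bar> / (1 / 2)" using x2 e0 by (intro divide_left_mono) auto
    also have "\<dots> \<le> e0 * (C * r) / (1 / 2)" using x e0 by (intro divide_right_mono mult_left_mono) auto
    also have "\<dots> < \<delta>" using r(5) by (simp add: mult_ac)
    finally show ?thesis .
  qed
  have rm: "r < m" "h / 2 \<le> m - r" using m(1) r \<rho> by (auto simp: abs_le_iff)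
  obtain w where w: "nontrivial_solution h \<epsilon> w"
    "\<And>x. x \<in> {0..1} \<Longrightarrow> \<bar>w x - m\<bar> \<le> r"
    "\<And>x. x \<in> {0..1} \<Longrightarrow> \<exists>\<phi>. \<epsilon> * dx w x = r * sin \<phi> * speed m r \<phi>"
    "\<And>x. x \<in> {0..1} \<Longrightarrow> \<epsilon>^2 * dx (dx w) x = - (nonlin (w x) - slope (m - r) (m + r))"
  proof (rule solution_of_phase[OF \<epsilon>(1) r(1) rm(1) k])
    show "0 < dd (m - r) (m + r) z" if "\<bar>z - m\<bar> \<le> r" for z using dd[OF r(1,2) m(1) that] by blast
    show "integral {0..2 * pi * real k} (\<lambda>\<phi>. 1 / speed m r \<phi>) = 1 / \<epsilon>" by (simp add: \<epsilon>_def I_def N_def)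
    show "integral {0..2 * pi * real k} (\<lambda>\<phi>. (m - h + r * cos \<phi>) / speed m r \<phi>) = 0" using m(2) by (simp add: N_def)
  qed blast
  have wC2: "w \<in> C2" using w(1) by (auto simp: nontrivial_solution_def solution_def)
  note dc = C2_diff_const[OF wC2, where c = h]
  have "C2_norm (\<lambda>x. w x - h) \<le> 2 * r + 2 * (nonlin1 h + 2) / e0 * r + 8 * M / e0^2 * r"
  proof (rule C2_norm_le)
    fix x :: real assume x: "x \<in> {0..1}"
    show "\<bar>w x - h\<bar> \<le> 2 * r" using w(2)[OF x] m(1) by linarith
    obtain \<phi> where \<phi>: "\<epsilon> * dx w x = r * sin \<phi> * speed m r \<phi>" using w(3)[OF x] by blast
    define Q where "Q = dd (m - r) (m + r) (m + r * cos \<phi>)"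
    have Q: "Q > 0" "Q \<le> nonlin1 h + 1"
      using dd[OF r(1,2) m(1), of "m + r * cos \<phi>"] cos_bound[of r \<phi>] r unfolding Q_def by (auto simp: abs_le_iff)
    have "sqrt Q \<le> Q + 1" using Q by (intro real_le_lsqrt) (auto simp: power2_eq_square algebra_simps)
    then have sq: "sqrt Q \<le> nonlin1 h + 2" using Q by simp
    have "\<epsilon> * \<bar>dx w x\<bar> = r * \<bar>sin \<phi>\<bar> * sqrt Q"
      using arg_cong[OF \<phi>, of abs] r(1) \<epsilon>(1) Q(1) by (simp add: abs_mult speed_def Q_def)
    also have "\<dots> \<le> r * 1 * (nonlin1 h + 2)" using r sq Q by (intro mult_mono) auto
    finally have "\<epsilon> * \<bar>dx w x\<bar> \<le> r * (nonlin1 h + 2)" by simp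
    moreover have "e0 / 2 * \<bar>dx w x\<bar> \<le> \<epsilon> * \<bar>dx w x\<bar>" using \<epsilon>2 by (intro mult_right_mono) auto
    ultimately have "\<bar>dx w x\<bar> \<le> 2 * (nonlin1 h + 2) / e0 * r" using e0 by (simp add: field_simps)
    then show "\<bar>dx (\<lambda>x. w x - h) x\<bar> \<le> 2 * (nonlin1 h + 2) / e0 * r" using dc(2)[OF x] by simp
    have "\<epsilon>^2 * \<bar>dx (dx w) x\<bar> = \<bar>\<epsilon>^2 * dx (dx w) x\<bar>" by (simp add: abs_mult)
    also have "\<dots> = \<bar>nonlin (w x) - slope (m - r) (m + r)\<bar>" unfolding w(4)[OF x] by (rule abs_minus_cancel)
    also have "\<dots> \<le> M * (m + r - (m - r))"
      unfolding M_def by (rule slope_bound[OF h rm(2)]) (use r(1) w(2)[OF x] in \<open>auto simp: abs_le_iff\<close>)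
    finally have "\<epsilon>^2 * \<bar>dx (dx w) x\<bar> \<le> 2 * M * r" by simp
    moreover have "(e0 / 2)^2 * \<bar>dx (dx w) x\<bar> \<le> \<epsilon>^2 * \<bar>dx (dx w) x\<bar>"
      using \<epsilon>2 e0 by (intro mult_right_mono power_mono) auto
    ultimately have "\<bar>dx (dx w) x\<bar> \<le> 8 * M / e0^2 * r" using e0 by (simp add: field_simps power2_eq_square)
    then show "\<bar>dx (dx (\<lambda>x. w x - h)) x\<bar> \<le> 8 * M / e0^2 * r" using dc(3)[OF x] by simp
  qed
  also have "\<dots> = K * r" by (simp add: K_def algebra_simps)
  also have "\<dots> < \<delta>" by (rule r(4))
  finally have "(\<epsilon>, w) \<in> nbhd h (eps h k) \<delta>"
    using \<epsilon> close wC2 by (simp add: nbhd_def e0_def)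
  then show "\<exists>(\<epsilon>, h')\<in>nbhd h (eps h k) \<delta>. nontrivial_solution h \<epsilon> h'"
    using w(1) by blast
qed

section \<open>Localisation of all small solutions\<close>

text \<open>A small C2 norm gives a small amplitude, and the first-order estimate then ties the
  number of turns to \<open>\<epsilon>\<close>. \<open>C\<close> is chosen before \<open>e0\<close>
  and \<open>\<eta>\<close>, so that \<open>\<eta>\<close> may later depend on it.\<close>

lemma near_bifurcation:
  fixes h :: real
  assumes h: "h > 0" and d1: "nonlin1 h > 0"
  obtains C where "C > 0"
    "\<And>e0 \<eta>. e0 > 0 \<Longrightarrow> \<eta> > 0 \<Longrightarrow>
      \<exists>\<delta>>0. \<forall>\<epsilon> w. (\<epsilon>, w) \<in> nbhd h e0 \<delta> \<longrightarrow> nontrivial_solution h \<epsilon> w \<longrightarrow> on_branch h C e0 \<eta> \<epsilon>"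
proof -
  obtain \<rho> C where \<rho>: "0 < \<rho>" "\<rho> < h / 4" "C > 0"
    and dd: "\<And>r m x. 0 < r \<Longrightarrow> r < \<rho> \<Longrightarrow> \<bar>m - h\<bar> \<le> r \<Longrightarrow> \<bar>x - m\<bar> \<le> r \<Longrightarrow>
       dd (m - r) (m + r) x > 0 \<and> \<bar>dd (m - r) (m + r) x - nonlin1 h\<bar> \<le> C * r"
    and est1: "\<And>r m \<alpha> n. 0 < r \<Longrightarrow> r < \<rho> \<Longrightarrow> \<bar>m - h\<bar> \<le> r \<Longrightarrow>
       \<bar>sqrt (nonlin1 h) * integral {\<alpha>..\<alpha> + 2 * pi * real n} (\<lambda>\<phi>. 1 / speed m r \<phi>) - 2 * pi * real n\<bar>
         \<le> C * r * (2 * pi * real n)"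
    and est2: "\<And>r m \<alpha> n. 0 < r \<Longrightarrow> r < \<rho> \<Longrightarrow> \<bar>m - h\<bar> \<le> r \<Longrightarrow> n > 0 \<Longrightarrow>
       integral {\<alpha>..\<alpha> + 2 * pi * real n} (\<lambda>\<phi>. (m - h + r * cos \<phi>) / speed m r \<phi>) = 0 \<Longrightarrow>
       \<bar>sqrt (nonlin1 h) * integral {\<alpha>..\<alpha> + 2 * pi * real n} (\<lambda>\<phi>. 1 / speed m r \<phi>)
         - 2 * pi * real n * (1 + branch_coeff h * r^2)\<bar> \<le> C * r^3 * (2 * pi * real n)"
    by (rule period_estimate[OF h d1]) (rule that)
  have main: "\<exists>\<delta>>0. \<forall>\<epsilon> w. (\<epsilon>, w) \<in> nbhd h e0 \<delta> \<longrightarrow> nontrivial_solution h \<epsilon> w \<longrightarrow> on_branch h C e0 \<eta> \<epsilon>"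
    if e0: "e0 > 0" and \<eta>: "\<eta> > 0" for e0 \<eta> :: real
  proof -
    define \<nu> where "\<nu> = sqrt (nonlin1 h) / (2 * pi * e0)"
    have \<nu>: "\<nu> > 0" using d1 e0 by (simp add: \<nu>_def)
    have "isCont (\<lambda>\<epsilon>. sqrt (nonlin1 h) / (2 * pi * \<epsilon>)) e0" using e0 by (intro continuous_intros) auto
    then obtain \<delta>1 where \<delta>1: "\<delta>1 > 0"
      "\<And>\<epsilon>. \<bar>\<epsilon> - e0\<bar> < \<delta>1 \<Longrightarrow> \<bar>sqrt (nonlin1 h) / (2 * pi * \<epsilon>) - \<nu>\<bar> < min (\<eta> / 2) 1"
      using \<eta> unfolding continuous_at_eps_delta dist_real_def \<nu>_def
      by (metis half_gt_zero_iff min_less_iff_conj zero_less_one)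
    have "eventually (\<lambda>r. 0 < r \<and> 1 * r < \<rho> \<and> 1 * r < \<eta> \<and> 1 * r < \<delta>1 \<and> C * r < 1 / 2 \<and> (2 * C * (\<nu> + 1)) * r < \<eta> / 2) (at_right 0)"
      by (intro eventually_conj eventually_mult_less eventually_at_right_less) (use \<rho> \<eta> \<delta>1 in auto)
    then obtain \<delta> where \<delta>: "0 < \<delta>" "\<delta> < \<rho>" "\<delta> < \<eta>" "\<delta> < \<delta>1" "C * \<delta> < 1 / 2" "2 * C * (\<nu> + 1) * \<delta> < \<eta> / 2"
      using eventually_happens'[OF trivial_limit_at_right_real] by force
    have "on_branch h C e0 \<eta> \<epsilon>"
      if nb: "(\<epsilon>, w) \<in> nbhd h e0 \<delta>" and nt: "nontrivial_solution h \<epsilon> w" for \<epsilon> w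
    proof -
      have \<epsilon>: "\<epsilon> > 0" "\<bar>\<epsilon> - e0\<bar> < \<delta>" and w: "w \<in> C2" "C2_norm (\<lambda>x. w x - h) < \<delta>"
        using nb by (auto simp: nbhd_def)
      have wh: "\<bar>w x - h\<bar> < \<delta>" if "x \<in> {0..1}" for x
        using C2_norm_ge[OF C2_diff_const(1)[OF w(1), of h] that] w(2) by simp
      obtain m r where mr: "0 < r" "r < m" "\<bar>m - h\<bar> \<le> r"
        "\<exists>y\<in>{0..1}. w y = m - r" "\<exists>y\<in>{0..1}. w y = m + r"
        "\<And>x. x \<in> {0..1} \<Longrightarrow> \<bar>w x - m\<bar> \<le> r"
        "\<And>x. x \<in> {0..1} \<Longrightarrow> \<epsilon>^2 * (dx w x)^2 = (m + r - w x) * (w x - (m - r)) * dd (m - r) (m + r) (w x)"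
        "\<And>x. x \<in> {0..1} \<Longrightarrow> \<epsilon>^2 * dx (dx w) x = - (nonlin (w x) - slope (m - r) (m + r))"
        by (rule solution_turning_points[OF nt]) (rule that)
      \<comment> \<open>Both extreme values lie within \<open>\<delta>\<close> of \<open>h\<close>,
        and they are \<open>2 * r\<close> apart.\<close>
      have r\<delta>: "r < \<delta>"
      proof -
        obtain y1 y2 where "y1 \<in> {0..1}" "w y1 = m - r" "y2 \<in> {0..1}" "w y2 = m + r" using mr(4,5) by blast
        with wh[of y1] wh[of y2] show ?thesis by (auto simp: abs_less_iff)
      qed
      have r\<rho>: "r < \<rho>" using r\<delta> \<delta> by simp
      obtain \<alpha> n where n: "n > 0"
        "integral {\<alpha>..\<alpha> + 2 * pi * real n} (\<lambda>\<phi>. 1 / speed m r \<phi>) = 1 / \<epsilon>"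
        "integral {\<alpha>..\<alpha> + 2 * pi * real n} (\<lambda>\<phi>. (m - h + r * cos \<phi>) / speed m r \<phi>) = 0"
        by (rule solution_phase[OF nt \<epsilon>(1) mr(1,2,6,7,8) dd[OF mr(1) r\<rho> mr(3), THEN conjunct1]])
      have E1: "\<bar>sqrt (nonlin1 h) / \<epsilon> - 2 * pi * real n\<bar> \<le> C * r * (2 * pi * real n)"
        using est1[OF mr(1) r\<rho> mr(3), of \<alpha> n] n(2) by simp
      have E2: "\<bar>sqrt (nonlin1 h) / \<epsilon> - 2 * pi * real n * (1 + branch_coeff h * r^2)\<bar> \<le> C * r^3 * (2 * pi * real n)"
        using est2[OF mr(1) r\<rho> mr(3) n(1,3)] n(2) by simp
      define y where "y = sqrt (nonlin1 h) / (2 * pi * \<epsilon>)"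
      have "\<bar>y - real n\<bar> * (2 * pi) = \<bar>(y - real n) * (2 * pi)\<bar>" by (simp add: abs_mult)
      also have "(y - real n) * (2 * pi) = sqrt (nonlin1 h) / \<epsilon> - 2 * pi * real n"
        using \<epsilon> by (simp add: y_def field_simps)
      finally have "\<bar>y - real n\<bar> * (2 * pi) \<le> (C * r * real n) * (2 * pi)" using E1 by (simp add: mult_ac)
      then have yn: "\<bar>y - real n\<bar> \<le> C * r * real n" by simp
      have Cr: "C * r \<le> C * \<delta>" using r\<delta> \<rho> by (intro mult_left_mono) auto
      then have "C * r * real n \<le> 1 / 2 * real n" using \<delta> by (intro mult_right_mono) auto
      moreover have y\<nu>: "\<bar>y - \<nu>\<bar> < \<eta> / 2" "\<bar>y - \<nu>\<bar> < 1"
        using \<delta>1(2)[of \<epsilon>] \<epsilon> \<delta> by (auto simp: y_def)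
      \<comment> \<open>The error \<open>C * r * n\<close> grows with \<open>n\<close>, so
        \<open>n\<close> is bounded first: \<open>n - y \<le> n / 2\<close> gives
        \<open>n \<le> 2 * y\<close>, and \<open>y < \<nu> + 1\<close>.\<close>
      ultimately have "real n \<le> 2 * (\<nu> + 1)" using abs_le_D2[OF yn] by (simp add: abs_less_iff)
      then have "C * r * real n \<le> C * \<delta> * (2 * (\<nu> + 1))"
        using Cr \<nu> \<rho> mr(1) \<delta>(1) by (intro mult_mono) auto
      also have "\<dots> < \<eta> / 2" using \<delta>(6) by (simp add: mult_ac)
      finally have "\<bar>real n - \<nu>\<bar> < \<eta>" using yn y\<nu> by linarith
      with mr(1) r\<delta> \<delta>(3) n(1) E2 show ?thesis
        unfolding on_branch_def \<nu>_def by (intro exI[of _ r] exI[of _ n]) auto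
    qed
    then show ?thesis using \<delta>(1) by blast
  qed
  show ?thesis by (rule that[OF \<rho>(3) main])
qed

text \<open>If \<open>\<nu>\<close> were not an integer, some neighbourhood of it would contain
  none, as the integers are closed; but solutions close to the constant supply turn numbers
  arbitrarily close to \<open>\<nu>\<close>.\<close>

lemma bifurcation_at_imp_eps:
  assumes h: "h > 0" and d1: "nonlin1 h > 0" and bif: "bifurcation_at h e0" and e0: "e0 > 0"
  shows "\<exists>k\<ge>1. e0 = eps h k"
proof -
  define \<nu> where "\<nu> = sqrt (nonlin1 h) / (2 * pi * e0)"
  have \<nu>: "\<nu> > 0" using d1 e0 by (simp add: \<nu>_def)
  have "\<nu> \<in> \<int>"
  proof (rule ccontr)
    assume "\<nu> \<notin> \<int>"
    moreover have "open (- (\<int> :: real set))" by (simp add: open_Compl closed_Ints)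
    ultimately obtain \<eta> where \<eta>: "\<eta> > 0" "\<And>y. \<bar>y - \<nu>\<bar> < \<eta> \<Longrightarrow> y \<notin> \<int>"
      unfolding open_dist dist_real_def by (metis ComplD ComplI)
    obtain C where near: "\<And>e0 \<eta>. e0 > 0 \<Longrightarrow> \<eta> > 0 \<Longrightarrow>
        \<exists>\<delta>>0. \<forall>\<epsilon> w. (\<epsilon>, w) \<in> nbhd h e0 \<delta> \<longrightarrow> nontrivial_solution h \<epsilon> w \<longrightarrow> on_branch h C e0 \<eta> \<epsilon>"
      by (rule near_bifurcation[OF h d1]) (rule that)
    obtain \<epsilon> where "on_branch h C e0 \<eta> \<epsilon>"
      using bif near[OF e0 \<eta>(1)] unfolding bifurcation_at_def by blast
    then obtain n :: nat where "\<bar>real n - \<nu>\<bar> < \<eta>" unfolding on_branch_def \<nu>_def by blast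
    then show False using \<eta>(2)[of "real n"] by simp
  qed
  then obtain i :: int where i: "\<nu> = of_int i" by (elim Ints_cases)
  then have "i > 0" using \<nu> by simp
  then obtain k :: nat where k: "k > 0" "i = int k" by (metis zero_less_imp_eq_int)
  then have "\<nu> = real k" using i by simp
  then have "e0 = eps h k" unfolding eps_eq[OF h] \<nu>_def using e0 k by (simp add: field_simps)
  then show ?thesis using k by (intro exI[of _ k]) auto
qed

section \<open>Sign of the branch coefficient and the critical means\<close>

text \<open>The sextic arises from \<open>f''^2 + 3 * f' * f'''\<close>, which equals it up to the
  factor \<open>12 / h^16\<close>.\<close>

lemma branch_coeff_eq:
  assumes "h > 0" "nonlin1 h > 0"
  shows "branch_coeff h = - (57 * h^6 - 426 * h^3 + 651) / (4 * h^16 * nonlin1 h ^ 2)"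
proof -
  have e: "nonlin2 h ^ 2 + 3 * nonlin1 h * nonlin3 h = 12 * (57 * h^6 - 426 * h^3 + 651) / h^16"
    using assms(1) unfolding nonlin1_def nonlin2_def nonlin3_def
    by (simp add: field_simps power2_eq_square)
  have "branch_coeff h = - (nonlin2 h ^ 2 + 3 * nonlin1 h * nonlin3 h) / (48 * nonlin1 h ^ 2)"
    using assms(2) unfolding branch_coeff_def ratio2_def ratio3_def by (simp add: field_simps power2_eq_square)
  then show ?thesis unfolding e using assms by (simp add: field_simps)
qed

lemma constant_solution:
  assumes "hbar > 0"
  shows "solution hbar \<epsilon> (\<lambda>x. hbar)"
proof -
  have C2: "(\<lambda>x. hbar) \<in> C2" "\<And>x. x \<in> {0..1} \<Longrightarrow> dx (\<lambda>x. hbar) x = 0" "\<And>x. x \<in> {0..1} \<Longrightarrow> dx (dx (\<lambda>x. hbar)) x = 0"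
    using C2I[of "\<lambda>x. hbar" "\<lambda>_. 0" "\<lambda>_. 0"] by auto
  then show ?thesis using assms by (auto simp: solution_def)
qed

text \<open>A quadratic in \<open>h^3\<close> with discriminant
  \<open>426^2 - 4 * 57 * 651 = 33048\<close> and leading denominator
  \<open>114 = 2 * 57\<close>.\<close>

lemma sextic_factorization:
  fixes h :: real
  shows "57 * h^6 - 426 * h^3 + 651 = 57 * (h^3 - (426 - sqrt 33048) / 114) * (h^3 - (426 + sqrt 33048) / 114)"
proof -
  have "57 * (z * z) - 426 * z + 651 = 57 * (z - (426 - s) / 114) * (z - (426 + s) / 114)"
    if "s * s = 33048" for z s :: real
    using that by (simp add: field_simps)
  from this[of "sqrt 33048" "h^3"] show ?thesis by (simp flip: power_add)
qed

text \<open>The upper bound 182 already gives \<open>(426 - sqrt 33048) / 114 > 2\<close>, which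
  places \<open>h_minus\<close> above \<open>root 3 2\<close>.\<close>

lemma sqrt_bounds: "181 < sqrt 33048" "sqrt 33048 < (182::real)"
proof -
  show "181 < sqrt 33048" by (rule real_less_rsqrt) simp
  show "sqrt 33048 < (182::real)" by (rule real_less_lsqrt) simp_all
qed

lemma h_pm:
  "h_minus ^ 3 = (426 - sqrt 33048) / 114" "h_plus ^ 3 = (426 + sqrt 33048) / 114"
  "0 < h_minus" "h_minus < h_plus" "root 3 2 < h_minus"
proof -
  note b = sqrt_bounds
  show "h_minus ^ 3 = (426 - sqrt 33048) / 114" "h_plus ^ 3 = (426 + sqrt 33048) / 114"
    unfolding h_minus_def h_plus_def using b by (simp_all add: real_root_pow_pos2)
  show "0 < h_minus" unfolding h_minus_def by (rule real_root_gt_zero) (use b in simp_all)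
  show "h_minus < h_plus" "root 3 2 < h_minus"
    unfolding h_minus_def h_plus_def by (rule real_root_less_mono; use b in simp)+
qed

lemma nonlin1_pos:
  assumes "h > root 3 2"
  shows "h > 0" "nonlin1 h > 0"
proof -
  have "root 3 2 > (0::real)" by simp
  with assms show h: "h > 0" by linarith
  have "root 3 2 ^ 3 < h ^ 3" using assms by (intro power_strict_mono) auto
  then have "h^3 > 2" by simp
  moreover have "nonlin1 h = 3 * (h^3 - 2) / h^7" using h by (simp add: nonlin1_def field_simps flip: power_add)
  ultimately show "nonlin1 h > 0" using h by simp
qed

theorem proposition1:
  shows "(\<forall>hbar>0. \<forall>\<epsilon>>0. solution hbar \<epsilon> (\<lambda>x. hbar))
    \<and> {h::real. h > 0 \<and> 57 * h ^ 6 - 426 * h ^ 3 + 651 = 0} = {h_minus, h_plus}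
    \<and> h_minus < h_plus
    \<and> (\<forall>hbar>root 3 2. \<forall>\<epsilon>>0. bifurcation_at hbar \<epsilon> \<longleftrightarrow> (\<exists>k\<ge>1. \<epsilon> = eps hbar k))
    \<and> (\<forall>hbar. h_minus < hbar \<and> hbar < h_plus \<longrightarrow>
          (\<forall>k\<ge>1. supercritical_at hbar (eps hbar k)))
    \<and> (\<forall>hbar. (root 3 2 < hbar \<and> hbar < h_minus) \<or> hbar > h_plus \<longrightarrow>
          (\<forall>k\<ge>1. subcritical_at hbar (eps hbar k)))"
proof (intro conjI)
  show "\<forall>hbar>0. \<forall>\<epsilon>>0. solution hbar \<epsilon> (\<lambda>x. hbar)" using constant_solution by blast
  have quad: "57 * h^6 - 426 * h^3 + 651 = 57 * (h^3 - h_minus^3) * (h^3 - h_plus^3)" for h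
    unfolding h_pm(1,2) by (rule sextic_factorization)
  show "{h::real. h > 0 \<and> 57 * h ^ 6 - 426 * h ^ 3 + 651 = 0} = {h_minus, h_plus}"
    unfolding quad using h_pm(3,4) by (auto dest: power_eq_imp_eq_base)
  show "h_minus < h_plus" by (rule h_pm(4))
  show "\<forall>hbar>root 3 2. \<forall>\<epsilon>>0. bifurcation_at hbar \<epsilon> \<longleftrightarrow> (\<exists>k\<ge>1. \<epsilon> = eps hbar k)"
    using bifurcation_at_imp_eps[OF nonlin1_pos] bifurcation_at_eps[OF nonlin1_pos] by (auto simp: Suc_le_eq)
  \<comment> \<open>Both directions at once: near the bifurcation point,
    \<open>1 / \<epsilon> - 1 / eps h k\<close> has the sign of
    \<open>branch_coeff h\<close>.\<close>
  have direction: "\<exists>\<delta>>0. \<forall>(\<epsilon>, w)\<in>nbhd h (eps h k) \<delta>. nontrivial_solution h \<epsilon> w \<longrightarrow>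
      0 < branch_coeff h * (1 / \<epsilon> - 1 / eps h k)"
    if h: "h > 0" and d1: "nonlin1 h > 0" and k: "k > 0" and nz: "branch_coeff h \<noteq> 0" for h :: real and k :: nat
  proof -
    define e0 where "e0 = eps h k"
    have e0: "e0 > 0" using d1 k by (simp add: e0_def eps_eq[OF h])
    have ek: "sqrt (nonlin1 h) / e0 = 2 * pi * real k" using d1 k by (simp add: e0_def eps_eq[OF h])
    obtain C where C: "C > 0" and near: "\<And>e0 \<eta>. e0 > 0 \<Longrightarrow> \<eta> > 0 \<Longrightarrow>
        \<exists>\<delta>>0. \<forall>\<epsilon> w. (\<epsilon>, w) \<in> nbhd h e0 \<delta> \<longrightarrow> nontrivial_solution h \<epsilon> w \<longrightarrow> on_branch h C e0 \<eta> \<epsilon>"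
      by (rule near_bifurcation[OF h d1]) (rule that)
    \<comment> \<open>The bound 1 forces the integer \<open>n\<close> to equal \<open>k\<close>; the
      bound \<open>\<bar>branch_coeff h\<bar> / C\<close> makes the cubic error smaller than the
      quadratic term, which therefore decides the sign of \<open>D\<close>.\<close>
    define \<eta> where "\<eta> = min 1 (\<bar>branch_coeff h\<bar> / C)"
    have \<eta>: "\<eta> > 0" using nz C by (simp add: \<eta>_def)
    obtain \<delta> where \<delta>: "\<delta> > 0" "\<And>\<epsilon> w. (\<epsilon>, w) \<in> nbhd h e0 \<delta> \<Longrightarrow> nontrivial_solution h \<epsilon> w \<Longrightarrow> on_branch h C e0 \<eta> \<epsilon>"
      using near[OF e0 \<eta>] by blast
    have "0 < branch_coeff h * (1 / \<epsilon> - 1 / e0)"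
      if nb: "(\<epsilon>, w) \<in> nbhd h e0 \<delta>" and nt: "nontrivial_solution h \<epsilon> w" for \<epsilon> w
    proof -
      obtain r n where rn: "0 < r" "r < \<eta>" "\<bar>real n - sqrt (nonlin1 h) / (2 * pi * e0)\<bar> < \<eta>"
        "\<bar>sqrt (nonlin1 h) / \<epsilon> - 2 * pi * real n * (1 + branch_coeff h * r^2)\<bar> \<le> C * r^3 * (2 * pi * real n)"
        using \<delta>(2)[OF nb nt] unfolding on_branch_def by blast
      have "sqrt (nonlin1 h) / (2 * pi * e0) = sqrt (nonlin1 h) / e0 / (2 * pi)" by simp
      also have "\<dots> = real k" unfolding ek by simp
      finally have "\<bar>real n - real k\<bar> < 1" using rn(3) by (simp add: \<eta>_def)
      then have nk: "n = k" by linarith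
      define N where "N = 2 * pi * real k"
      have N: "N > 0" using k by (simp add: N_def)
      define D where "D = sqrt (nonlin1 h) / \<epsilon> - sqrt (nonlin1 h) / e0"
      have "\<bar>D - N * (branch_coeff h * r^2)\<bar> \<le> C * r^3 * N"
        using rn(4) unfolding nk D_def ek by (simp add: N_def algebra_simps)
      moreover have "C * r^3 * N < N * (\<bar>branch_coeff h\<bar> * r^2)"
      proof -
        have "C * r < \<bar>branch_coeff h\<bar>" using rn(2) C by (simp add: \<eta>_def field_simps)
        then have "C * r * (r^2 * N) < \<bar>branch_coeff h\<bar> * (r^2 * N)" using rn(1) N by (intro mult_strict_right_mono) auto
        then show ?thesis by (simp add: power3_eq_cube power2_eq_square mult_ac)
      qed
      ultimately have *: "\<bar>D - N * (branch_coeff h * r^2)\<bar> < N * (\<bar>branch_coeff h\<bar> * r^2)" by linarith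
      have "0 < branch_coeff h * D"
      proof (cases "branch_coeff h > 0")
        case True
        then have "D > 0" using * by (simp add: abs_less_iff)
        then show ?thesis using True by simp
      next
        case False
        then have kn: "branch_coeff h < 0" using nz by simp
        then have "D < 0" using * by (simp add: abs_less_iff)
        then show ?thesis using kn by (simp add: mult_neg_neg)
      qed
      also have "branch_coeff h * D = sqrt (nonlin1 h) * (branch_coeff h * (1 / \<epsilon> - 1 / e0))" by (simp add: D_def algebra_simps)
      finally show ?thesis using d1 by (simp add: zero_less_mult_iff)
    qed
    then show ?thesis using \<delta>(1) unfolding e0_def by blast
  qed
  have den: "4 * h^16 * nonlin1 h ^ 2 > 0" if "h > root 3 2" for h
    using nonlin1_pos[OF that] by simp
  show "\<forall>hbar. h_minus < hbar \<and> hbar < h_plus \<longrightarrow> (\<forall>k\<ge>1. supercritical_at hbar (eps hbar k))"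
  proof (intro allI impI)
    fix h and k :: nat assume H: "h_minus < h \<and> h < h_plus" and k: "1 \<le> k"
    have hr: "h > root 3 2" using H h_pm by linarith
    note pos = nonlin1_pos[OF hr]
    have "h_minus ^ 3 < h ^ 3" "h ^ 3 < h_plus ^ 3" using H h_pm pos by (auto intro!: power_strict_mono)
    then have "57 * h^6 - 426 * h^3 + 651 < 0" unfolding quad by (intro mult_pos_neg) auto
    then have kp: "branch_coeff h > 0" unfolding branch_coeff_eq[OF pos] using den[OF hr] by (intro divide_pos_pos) auto
    show "supercritical_at h (eps h k)"
      unfolding supercritical_at_def using bifurcation_at_eps[OF pos, of k] direction[OF pos, of k] kp k
      by (auto simp: zero_less_mult_iff Suc_le_eq)
  qed
  show "\<forall>hbar. (root 3 2 < hbar \<and> hbar < h_minus) \<or> hbar > h_plus \<longrightarrow> (\<forall>k\<ge>1. subcritical_at hbar (eps hbar k))"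
  proof (intro allI impI)
    fix h and k :: nat assume H: "(root 3 2 < h \<and> h < h_minus) \<or> h > h_plus" and k: "1 \<le> k"
    have hr: "h > root 3 2" using H h_pm by linarith
    note pos = nonlin1_pos[OF hr]
    have "(h ^ 3 < h_minus ^ 3 \<and> h ^ 3 < h_plus ^ 3) \<or> (h ^ 3 > h_minus ^ 3 \<and> h ^ 3 > h_plus ^ 3)"
      using H h_pm(3,4) pos by (auto intro!: power_strict_mono)
    then have "57 * h^6 - 426 * h^3 + 651 > 0" unfolding quad by (auto intro: mult_neg_neg)
    then have kp: "branch_coeff h < 0" unfolding branch_coeff_eq[OF pos] using den[OF hr] by (intro divide_neg_pos) auto
    show "subcritical_at h (eps h k)"
      unfolding subcritical_at_def using bifurcation_at_eps[OF pos, of k] direction[OF pos, of k] kp k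
      by (auto simp: zero_less_mult_iff Suc_le_eq)
  qed
qed

end
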